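(* Let $b\ge 2$ be an integer, let $\alpha,\lambda>0$, and let $A\subset\mathbb{R}$, $A\notin\{\emptyset,\mathbb{R}\}$, be a finite union of $r_A\ge1$ pairwise disjoint intervals with endpoints $-\infty\le a_j<b_j\le\infty$. Let $\nu$ be the standard Gaussian measure on $\mathbb{R}$ and $g_A(x)=\nu(A-x)$. Suppose that for some $\sigma\in\{-1,1\}$ the map $t\mapsto g_A(\sigma t)$ is strictly increasing on $\mathbb{R}$. Fix $p\in(\nu(A),M_A)$. With $M_A$, $I_A$, $Q_A$ and $Q_A(p+)$ as in the context, $Q_A(p+)=Q_A(p)$, and the following hold. (i) If $0<\alpha\le1$, then $$Q_A(p)=\lambda\min\Big\{\sum_{i=1}^b t_i^\alpha:\ t_i\ge0,\ \frac1b\sum_{i=1}^b g_A(\sigma t_i)\ge p\Big\},$$ and the minimum is attained. (ii) If $\alpha\ge1$ and $t\mapsto g_A(\sigma t)$ is concave on $[0,\infty)$, then $$Q_A(p)=\begin{cases}\lambda b\,I_A(p),&\alpha=1,\\ \lambda\big(b^{1/(\alpha-1)}-1\big)^{\alpha-1}I_A(p)^\alpha,&\alpha>1.\end{cases}$$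
   Context: $A-x=\{a-x:a\in A\}$; $M_A=\sup_{x\in\mathbb{R}}g_A(x)$; $I_A(p)=\inf\{|x|:x\in\mathbb{R},\ \nu(A-x)\ge p\}$. $\mathbb{T}_b=\bigcup_{k\ge0}\{1,\dots,b\}^k$ is the rooted $b$-ary tree with root $\varnothing$; $|v|$ is the length of $v$. $\mathcal{H}_b$ is the set of real fields $h=(h_v)_{v\in\mathbb{T}_b}$ with $h_\varnothing=0$ and $\|h\|_b:=\sum_{k\ge1}b^{-k}\sum_{|v|=k}|h_v|<\infty$. $\partial\mathbb{T}_b=\{1,\dots,b\}^{\{1,2,\dots\}}$ carries the product $\sigma$-algebra and the product measure $\mathbf{m}_b$ of uniform measures on $\{1,\dots,b\}$; $\xi|k$ is the vector of the first $k$ coordinates of $\xi$. For $h\in\mathcal{H}_b$, $H_h(\xi)=\sum_{k\ge1}h_{\xi|k}$ (absolutely convergent for $\mathbf{m}_b$-a.e. $\xi$), $\Psi_A(h)=\int_{\partial\mathbb{T}_b}g_A(H_h(\xi))\,\mathbf{m}_b(d\xi)$, $\mathcal{I}_\alpha(h)=\lambda\sum_{v\ne\varnothing}|h_v|^\alpha\in[0,\infty]$, and $Q_A(q)=\inf\{\mathcal{I}_\alpha(h):h\in\mathcal{H}_b,\ \Psi_A(h)=q\}$ for $q\in[0,1]$, with $\inf\emptyset=\infty$. $Q_A$ is strictly increasing on $[\nu(A),M_A)$, and $Q_A(p+):=\lim_{q\downarrow p}Q_A(q)$. *)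

theory Defs
  imports "HOL-Probability.Probability"
begin

(* J is an interval with extended endpoints l and u, each (finite) endpoint being
   included or not: J lies between the open and the closed interval. *)
definition interval_with_endpoints :: "real set \<Rightarrow> ereal \<Rightarrow> ereal \<Rightarrow> bool" where
  "interval_with_endpoints J l u \<longleftrightarrow>
     {x. l < ereal x \<and> ereal x < u} \<subseteq> J \<and> J \<subseteq> {x. l \<le> ereal x \<and> ereal x \<le> u}"

definition disjoint_interval_union :: "nat \<Rightarrow> real set \<Rightarrow> bool" where
  "disjoint_interval_union r A \<longleftrightarrow>
     (\<exists>(J :: nat \<Rightarrow> real set) l u.
        (\<forall>j<r. l j < u j \<and> interval_with_endpoints (J j) (l j) (u j)) \<and>
        disjoint_family_on J {..<r} \<and> A = (\<Union>j<r. J j))"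

abbreviation gauss :: "real measure" where
  "gauss \<equiv> std_normal_distribution"

definition shifted_measure :: "real set \<Rightarrow> real \<Rightarrow> real" where
  "shifted_measure A x = measure gauss ((\<lambda>a. a - x) ` A)"

definition sup_shifted_measure :: "real set \<Rightarrow> real" where
  "sup_shifted_measure A = (SUP x. shifted_measure A x)"

(* The set is nonempty whenever p < sup_shifted_measure A; real Inf is only meant in that case. *)
definition min_shift :: "real set \<Rightarrow> real \<Rightarrow> real" where
  "min_shift A p = Inf {\<bar>x\<bar> | x. shifted_measure A x \<ge> p}"

definition tree_level :: "nat \<Rightarrow> nat \<Rightarrow> nat list set" where
  "tree_level b k = {v. length v = k \<and> set v \<subseteq> {1..b}}"

definition tree :: "nat \<Rightarrow> nat list set" where
  "tree b = (\<Union>k. tree_level b k)"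

definition tree_norm :: "nat \<Rightarrow> (nat list \<Rightarrow> real) \<Rightarrow> ennreal" where
  "tree_norm b h =
     (\<Sum>k. ennreal ((1 / real b) ^ Suc k * (\<Sum>v\<in>tree_level b (Suc k). \<bar>h v\<bar>)))"

(* Fields are total functions on lists; the values outside the tree are never used. *)
definition tree_fields :: "nat \<Rightarrow> (nat list \<Rightarrow> real) set" where
  "tree_fields b = {h. h [] = 0 \<and> tree_norm b h < \<infinity>}"

(* The space of this measure is the set of extensional functions from {1..} to {1..b}. *)
definition boundary_measure :: "nat \<Rightarrow> (nat \<Rightarrow> nat) measure" where
  "boundary_measure b = (\<Pi>\<^sub>M i\<in>{1..}. uniform_count_measure {1..b})"

definition ray_prefix :: "(nat \<Rightarrow> nat) \<Rightarrow> nat \<Rightarrow> nat list" where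
  "ray_prefix \<xi> k = map \<xi> [1..<Suc k]"

definition ray_sum :: "(nat list \<Rightarrow> real) \<Rightarrow> (nat \<Rightarrow> nat) \<Rightarrow> real" where
  "ray_sum h \<xi> = (\<Sum>k. h (ray_prefix \<xi> (Suc k)))"

definition mean_measure :: "nat \<Rightarrow> real set \<Rightarrow> (nat list \<Rightarrow> real) \<Rightarrow> real" where
  "mean_measure b A h = (\<integral>\<xi>. shifted_measure A (ray_sum h \<xi>) \<partial>boundary_measure b)"

definition field_cost :: "nat \<Rightarrow> real \<Rightarrow> real \<Rightarrow> (nat list \<Rightarrow> real) \<Rightarrow> ennreal" where
  "field_cost b \<alpha> lam h =
     ennreal lam * (\<integral>\<^sup>+ v. ennreal (\<bar>h v\<bar> powr \<alpha>) \<partial>count_space (tree b - {[]}))"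

definition min_cost :: "nat \<Rightarrow> real \<Rightarrow> real \<Rightarrow> real set \<Rightarrow> real \<Rightarrow> ennreal" where
  "min_cost b \<alpha> lam A q =
     (INF h\<in>{h \<in> tree_fields b. mean_measure b A h = q}. field_cost b \<alpha> lam h)"

definition min_cost_right :: "nat \<Rightarrow> real \<Rightarrow> real \<Rightarrow> real set \<Rightarrow> real \<Rightarrow> ennreal" where
  "min_cost_right b \<alpha> lam A p = Lim (at_right p) (min_cost b \<alpha> lam A)"

(* Costs, without the factor lam, of the admissible one-level fields; note 0 powr \<alpha> = 0. *)
definition one_level_costs :: "nat \<Rightarrow> real \<Rightarrow> real set \<Rightarrow> real \<Rightarrow> real \<Rightarrow> real set" where
  "one_level_costs b \<alpha> A \<sigma> p =
     {(\<Sum>i=1..b. t i powr \<alpha>) | t :: nat \<Rightarrow> real.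
        (\<forall>i\<in>{1..b}. t i \<ge> 0) \<and>
        (1 / real b) * (\<Sum>i=1..b. shifted_measure A (\<sigma> * t i)) \<ge> p}"

end

theory Submission
  imports Defs
begin

text \<open>Write \<open>G t\<close> for \<open>shifted_measure A (\<sigma> * t)\<close>, a continuous strictly increasing function.
  Scaling a field down gives \<open>min_cost\<close> for the constraint \<open>\<ge> q\<close> in place of \<open>= q\<close>, hence
  monotonicity in \<open>q\<close>; increasing the field at one vertex of the first level by a small amount
  strictly raises the mean at a small additional cost, hence right continuity.  For \<open>\<alpha> \<le> 1\<close>,
  subadditivity of \<open>x powr \<alpha>\<close> makes it optimal to concentrate each subtree at its root on
  the first level.  If \<open>G\<close> is concave on \<open>{0..}\<close>, Jensen's inequality turns the
  constraint \<open>G T = p\<close> into \<open>tree_norm b h \<ge> T\<close>, and minimising the cost under this linear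
  constraint is a Hoelder inequality with an explicit radial optimiser.\<close>

section \<open>Regularity of the Gaussian measure of a translated set\<close>

lemma interval_with_endpoints_frontier_finite:
  assumes "interval_with_endpoints J l u"
  shows "finite (frontier J)"
proof -
  have op: "open {x. l < ereal x \<and> ereal x < u}"
    by (intro open_Collect_conj open_Collect_less continuous_intros)
  have cl: "closed {x. l \<le> ereal x \<and> ereal x \<le> u}"
    by (intro closed_Collect_conj closed_Collect_le continuous_intros)
  have "{x. l < ereal x \<and> ereal x < u} \<subseteq> interior J"
    using assms op by (intro interior_maximal) (auto simp: interval_with_endpoints_def)
  moreover have "closure J \<subseteq> {x. l \<le> ereal x \<and> ereal x \<le> u}"
    using assms cl by (intro closure_minimal) (auto simp: interval_with_endpoints_def)
  \<comment> \<open>A frontier point lies in the closed interval but not in the open one, so it is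
    an endpoint. For an infinite endpoint \<open>real_of_ereal\<close> returns 0, which only adds a
    harmless point to the finite cover of the frontier.\<close>
  ultimately have "x = real_of_ereal l \<or> x = real_of_ereal u" if "x \<in> frontier J" for x
    using that real_of_ereal.simps(1)[of x] unfolding frontier_def
    by (metis (no_types, lifting) DiffE mem_Collect_eq order_le_less subset_iff)
  then have "frontier J \<subseteq> {real_of_ereal l, real_of_ereal u}"
    by blast
  then show ?thesis
    by (rule finite_subset) simp
qed

lemma finite_frontier_UN:
  assumes "finite I" "\<And>i. i \<in> I \<Longrightarrow> finite (frontier (J i))"
  shows "finite (frontier (\<Union>i\<in>I. J i))"
  using assms
proof (induction I rule: finite_induct)
  case (insert i I)
  have "frontier (\<Union>i\<in>insert i I. J i) \<subseteq> frontier (J i) \<union> frontier (\<Union>i\<in>I. J i)"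
    using frontier_Un_subset[of "J i" "\<Union>i\<in>I. J i"] by simp
  then show ?case
    using insert by (meson finite_UnI finite_subset insertCI)
qed simp

text \<open>Finiteness of the frontier is the regularity of \<open>A\<close> that yields both
  measurability and continuity of \<open>shifted_measure A\<close>.\<close>

lemma disjoint_interval_union_frontier_finite:
  assumes "disjoint_interval_union r A"
  shows "finite (frontier A)"
proof -
  obtain J l u where "\<And>j. j < r \<Longrightarrow> interval_with_endpoints (J j) (l j) (u j)"
    and A: "A = (\<Union>j<r. J j)"
    using assms unfolding disjoint_interval_union_def by metis
  then show ?thesis
    unfolding A by (intro finite_frontier_UN) (auto intro: interval_with_endpoints_frontier_finite)
qed

lemma borel_of_finite_frontier:
  fixes A :: "real set"
  assumes "finite (frontier A)"
  shows "A \<in> sets borel"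
proof -
  have "A = interior A \<union> (A \<inter> frontier A)"
    using interior_subset[of A] closure_subset[of A] unfolding frontier_def by auto
  moreover have "finite (A \<inter> frontier A)"
    using assms by auto
  ultimately show ?thesis
    by (metis borel_open finite_imp_closed borel_closed open_interior sets.Un)
qed

text \<open>The translation passes from the set into the integrand, which prepares dominated
  convergence in \<open>x\<close>.\<close>

lemma shifted_measure_eq_integral:
  assumes "A \<in> sets borel"
  shows "shifted_measure A x = (\<integral>y. indicator A (y + x) \<partial>gauss)"
proof -
  have eq: "(\<lambda>a. a - x) ` A = {y. y + x \<in> A}"
    by (force simp: image_iff)
  have "{y. y + x \<in> A} \<in> sets borel"
    using measurable_sets[of "\<lambda>y. y + x" borel borel A] assms by (simp add: vimage_def)
  then have "shifted_measure A x = (\<integral>y. indicator {y. y + x \<in> A} y \<partial>gauss)"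
    unfolding shifted_measure_def eq by simp
  then show ?thesis
    by (simp add: indicator_def)
qed

text \<open>An indicator is continuous off the frontier, and only finitely many \<open>y\<close> put
  \<open>y + x\<close> on it. As \<open>gauss\<close> has a Lebesgue density, these form a null set,
  and dominated convergence with bound 1 applies.\<close>

lemma isCont_shifted_measure:
  assumes fin: "finite (frontier A)"
  shows "isCont (shifted_measure A) x"
proof -
  have A [measurable]: "A \<in> sets borel"
    by (rule borel_of_finite_frontier[OF fin])
  have "(\<lambda>n. shifted_measure A (X n)) \<longlonglongrightarrow> shifted_measure A x" if X: "X \<longlonglongrightarrow> x" for X
    unfolding shifted_measure_eq_integral[OF A]
  proof (rule integral_dominated_convergence[where w = "\<lambda>_. 1"])
    have "finite ((\<lambda>z. z - x) ` frontier A)"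
      using fin by simp
    then have "AE y in lborel. y \<notin> (\<lambda>z. z - x) ` frontier A"
      by (intro AE_not_in countable_imp_null_set_lborel countable_finite)
    then have "AE y in lborel. (\<lambda>n. indicator A (y + X n) :: real) \<longlonglongrightarrow> indicator A (y + x)"
    proof eventually_elim
      case (elim y)
      then have "y + x \<notin> frontier A"
        by (metis add_diff_cancel_right' imageI)
      then have "isCont (indicator A :: real \<Rightarrow> real) (y + x)"
        by (simp add: isCont_indicator)
      then show ?case
        by (rule isCont_tendsto_compose) (intro tendsto_intros X)
    qed
    then show "AE y in gauss. (\<lambda>n. indicator A (y + X n) :: real) \<longlonglongrightarrow> indicator A (y + x)"
      by (subst AE_density) auto
  next
    interpret prob_space gauss
      by (rule prob_space_normal_density) simp
    show "integrable gauss (\<lambda>_. 1 :: real)"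
      by simp
  qed (auto simp: indicator_def)
  then show ?thesis
    by (simp add: continuous_at_sequentially o_def)
qed

lemma shifted_measure_0: "shifted_measure A 0 = measure gauss A"
  by (simp add: shifted_measure_def)

lemma shifted_measure_nonneg: "0 \<le> shifted_measure A x"
  by (simp add: shifted_measure_def)

lemma shifted_measure_le_1: "shifted_measure A x \<le> 1"
  unfolding shifted_measure_def
  by (intro prob_space.prob_le_1 prob_space_normal_density) simp

section \<open>Levels of the tree and the boundary measure\<close>

lemma tree_level_finite [simp]: "finite (tree_level b k)"
  unfolding tree_level_def
  using finite_lists_length_eq[of "{1..b}" k] by (simp add: conj_commute)

lemma card_tree_level: "card (tree_level b k) = b ^ k"
  unfolding tree_level_def
  using card_lists_length_eq[of "{1..b}" k] by (simp add: conj_commute)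

lemma tree_level_1: "tree_level b (Suc 0) = (\<lambda>i. [i]) ` {1..b}"
  by (auto simp: tree_level_def length_Suc_conv)

lemma sum_tree_level_1: "(\<Sum>v\<in>tree_level b (Suc 0). f v) = (\<Sum>i=1..b. f [i])"
  unfolding tree_level_1 by (subst sum.reindex) (auto simp: inj_on_def)

lemma ray_prefix_1: "ray_prefix \<xi> (Suc 0) = [\<xi> 1]"
  by (simp add: ray_prefix_def)

lemma length_ray_prefix [simp]: "length (ray_prefix \<xi> k) = k"
  by (simp add: ray_prefix_def)

lemma nth_ray_prefix: "i < k \<Longrightarrow> ray_prefix \<xi> k ! i = \<xi> (Suc i)"
  by (simp add: ray_prefix_def del: upt_Suc)

lemma hd_ray_prefix: "hd (ray_prefix \<xi> (Suc k)) = \<xi> 1"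
  by (simp add: ray_prefix_def hd_map del: upt_Suc)

lemma space_boundary: "space (boundary_measure b) = {1..} \<rightarrow>\<^sub>E {1..b}"
  by (simp add: boundary_measure_def space_PiM space_uniform_count_measure)

lemma ray_prefix_in_level:
  "\<xi> \<in> space (boundary_measure b) \<Longrightarrow> ray_prefix \<xi> k \<in> tree_level b k"
  by (auto simp: space_boundary tree_level_def ray_prefix_def PiE_iff)

lemma nth_tree_level: "v \<in> tree_level b k \<Longrightarrow> i \<in> {1..k} \<Longrightarrow> v ! (i - 1) \<in> {1..b}"
  by (rule subsetD[of "set v"]) (auto simp: tree_level_def)

text \<open>Prefix events become product cylinders, whose measure can be computed. Ray coordinates
  start at 1 and list positions at 0, hence the index \<open>i - 1\<close>.\<close>

lemma prefix_cylinder: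
  "v \<in> tree_level b k \<Longrightarrow>
    {\<xi>\<in>space (boundary_measure b). ray_prefix \<xi> k = v} =
    {\<xi>\<in>space (boundary_measure b). \<forall>i\<in>{1..k}. \<xi> i \<in> {v ! (i - 1)}}"
  using image_Suc_lessThan[of k, symmetric]
  by (auto simp: tree_level_def list_eq_iff_nth_eq nth_ray_prefix)

text \<open>Values in \<open>ennreal\<close> make this sum meaningful on every ray, also where the
  series of \<open>ray_sum\<close> diverges.\<close>

definition ray_abs_sum :: "(nat list \<Rightarrow> real) \<Rightarrow> (nat \<Rightarrow> nat) \<Rightarrow> ennreal" where
  "ray_abs_sum h \<xi> = (\<Sum>k. ennreal \<bar>h (ray_prefix \<xi> (Suc k))\<bar>)"

context
  fixes b :: nat
  assumes b: "b > 0"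
begin

interpretation product_prob_space "\<lambda>_. uniform_count_measure {1..b}" "{1..}::nat set"
  using b by (intro product_prob_spaceI prob_space_uniform_count_measure) auto

lemma prob_space_boundary: "prob_space (boundary_measure b)"
  unfolding boundary_measure_def by unfold_locales

lemma prefix_cylinder_sets:
  assumes "v \<in> tree_level b k"
  shows "{\<xi>\<in>space (boundary_measure b). ray_prefix \<xi> k = v} \<in> sets (boundary_measure b)"
proof -
  have "{\<xi>\<in>space (Pi\<^sub>M {1..} (\<lambda>_. uniform_count_measure {1..b})). \<xi> i \<in> {v ! (i - 1)}}
    \<in> sets (Pi\<^sub>M {1..} (\<lambda>_. uniform_count_measure {1..b}))" if "i \<in> {1..k}" for i
    using that nth_tree_level[OF assms that]
    by (intro sets_Collect_single) (auto simp: sets_uniform_count_measure)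
  then show ?thesis
    unfolding prefix_cylinder[OF assms] unfolding boundary_measure_def
    by (intro sets.sets_Collect_finite_All) auto
qed

lemma emeasure_prefix_cylinder:
  assumes v: "v \<in> tree_level b k"
  shows "emeasure (boundary_measure b) {\<xi>\<in>space (boundary_measure b). ray_prefix \<xi> k = v}
    = ennreal ((1 / real b) ^ k)"
proof -
  note mem = nth_tree_level[OF v]
  have "emeasure (boundary_measure b) {\<xi>\<in>space (boundary_measure b). ray_prefix \<xi> k = v}
    = (\<Prod>i\<in>{1..k}. emeasure (uniform_count_measure {1..b}) {v ! (i - 1)})"
    unfolding prefix_cylinder[OF v] unfolding boundary_measure_def
    by (rule emeasure_PiM_Collect) (use mem in \<open>auto simp: sets_uniform_count_measure\<close>)
  also have "\<dots> = (\<Prod>i\<in>{1..k}. ennreal (1 / real b))"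
    by (intro prod.cong refl) (use mem b in \<open>auto simp: emeasure_uniform_count_measure\<close>)
  finally show ?thesis
    by (simp add: ennreal_power)
qed

lemma measurable_ray_prefix:
  "(\<lambda>\<xi>. ray_prefix \<xi> k) \<in> measurable (boundary_measure b) (count_space (tree_level b k))"
  using prefix_cylinder_sets
  by (subst measurable_count_space_eq2)
     (auto simp: ray_prefix_in_level vimage_def Int_def conj_commute prefix_cylinder_sets)

lemma measurable_ray_prefix_fun [measurable]:
  "(\<lambda>\<xi>. f (ray_prefix \<xi> k)) \<in> borel_measurable (boundary_measure b)"
  by (rule measurable_compose[OF measurable_ray_prefix]) simp

text \<open>The integrand is a finite combination of indicators of the cylinders of level
  \<open>k\<close>, which all have the same mass.\<close>

lemma nn_integral_ray_prefix:
  fixes f :: "nat list \<Rightarrow> ennreal"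
  shows "(\<integral>\<^sup>+\<xi>. f (ray_prefix \<xi> k) \<partial>boundary_measure b)
    = ennreal ((1 / real b) ^ k) * (\<Sum>v\<in>tree_level b k. f v)"
proof -
  let ?S = "\<lambda>v. {\<xi>\<in>space (boundary_measure b). ray_prefix \<xi> k = v}"
  have "(\<integral>\<^sup>+\<xi>. f (ray_prefix \<xi> k) \<partial>boundary_measure b)
    = (\<integral>\<^sup>+\<xi>. (\<Sum>v\<in>tree_level b k. f v * indicator (?S v) \<xi>) \<partial>boundary_measure b)"
    by (intro nn_integral_cong)
       (simp add: indicator_def if_distrib sum.delta' ray_prefix_in_level cong: if_cong)
  also have "\<dots> = (\<Sum>v\<in>tree_level b k. f v * ennreal ((1 / real b) ^ k))"
    using prefix_cylinder_sets
    by (subst nn_integral_sum) (auto simp: nn_integral_cmult_indicator emeasure_prefix_cylinder)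
  finally show ?thesis
    by (simp add: sum_distrib_left sum_distrib_right mult.commute)
qed

lemma integral_ray_prefix:
  fixes f :: "nat list \<Rightarrow> real"
  shows "(\<integral>\<xi>. f (ray_prefix \<xi> k) \<partial>boundary_measure b)
    = (1 / real b) ^ k * (\<Sum>v\<in>tree_level b k. f v)"
proof -
  interpret B: prob_space "boundary_measure b"
    by (rule prob_space_boundary)
  let ?S = "\<lambda>v. {\<xi>\<in>space (boundary_measure b). ray_prefix \<xi> k = v}"
  have m: "measure (boundary_measure b) (?S v) = (1 / real b) ^ k" if "v \<in> tree_level b k" for v
    using emeasure_prefix_cylinder[OF that] by (simp add: measure_def)
  have "(\<integral>\<xi>. f (ray_prefix \<xi> k) \<partial>boundary_measure b)
    = (\<integral>\<xi>. (\<Sum>v\<in>tree_level b k. f v * indicator (?S v) \<xi>) \<partial>boundary_measure b)"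
    by (intro Bochner_Integration.integral_cong refl)
       (simp add: indicator_def if_distrib sum.delta' ray_prefix_in_level cong: if_cong)
  also have "\<dots> = (\<Sum>v\<in>tree_level b k. f v * (1 / real b) ^ k)"
    by (subst Bochner_Integration.integral_sum) (auto simp: m prefix_cylinder_sets less_top[symmetric]
        intro!: integrable_mult_right integrable_real_indicator)
  finally show ?thesis
    by (simp add: sum_distrib_left sum_distrib_right mult.commute)
qed

lemma measurable_ray_sum [measurable]:
  "ray_sum h \<in> borel_measurable (boundary_measure b)"
  unfolding ray_sum_def by measurable

lemma measurable_ray_abs_sum [measurable]:
  "ray_abs_sum h \<in> borel_measurable (boundary_measure b)"
  unfolding ray_abs_sum_def by measurable

lemma nn_integral_ray_abs_sum:
  "(\<integral>\<^sup>+\<xi>. ray_abs_sum h \<xi> \<partial>boundary_measure b) = tree_norm b h"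
  unfolding ray_abs_sum_def tree_norm_def
  by (subst nn_integral_suminf)
     (auto simp: nn_integral_ray_prefix[of "\<lambda>v. ennreal \<bar>h v\<bar>"] ennreal_mult sum_nonneg
       simp del: power_Suc)

text \<open>A nonnegative function with finite integral is finite almost everywhere. This makes
  \<open>ray_sum\<close> a genuine sum on almost every ray.\<close>

lemma AE_summable_ray:
  assumes "tree_norm b h < \<infinity>"
  shows "AE \<xi> in boundary_measure b. summable (\<lambda>k. \<bar>h (ray_prefix \<xi> (Suc k))\<bar>)"
proof -
  have "AE \<xi> in boundary_measure b. ray_abs_sum h \<xi> \<noteq> \<infinity>"
    using assms by (intro nn_integral_noteq_infinite) (auto simp: nn_integral_ray_abs_sum)
  then show ?thesis
    by eventually_elim (auto simp: ray_abs_sum_def intro: summable_suminf_not_top)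
qed

lemma AE_ray_sum_le:
  assumes "tree_norm b h < \<infinity>"
  shows "AE \<xi> in boundary_measure b. ennreal \<bar>ray_sum h \<xi>\<bar> \<le> ray_abs_sum h \<xi>"
  using AE_summable_ray[OF assms]
proof eventually_elim
  case (elim \<xi>)
  then show ?case
    unfolding ray_sum_def ray_abs_sum_def
    by (subst suminf_ennreal2) (auto intro!: ennreal_leI summable_rabs)
qed

end

section \<open>Cost and norm as sums over levels\<close>

lemma field_cost_eq_levels:
  "field_cost b \<alpha> lam h =
    ennreal lam * (\<Sum>k. \<Sum>v\<in>tree_level b (Suc k). ennreal (\<bar>h v\<bar> powr \<alpha>))"
proof -
  let ?f = "\<lambda>v. ennreal (\<bar>h v\<bar> powr \<alpha>)"
  let ?X = "tree b - {[]}"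
  have sub: "tree_level b (Suc k) \<subseteq> ?X" for k
    by (auto simp: tree_def tree_level_def)
  \<comment> \<open>Every nonempty vertex lies on exactly one level.\<close>
  have one: "(\<Sum>k. indicator (tree_level b (Suc k)) v) = (1 :: ennreal)" if "v \<in> ?X" for v
  proof -
    from that obtain n where n: "v \<in> tree_level b (Suc n)"
      by (auto simp: tree_def tree_level_def length_Suc_conv neq_Nil_conv)
    then have "(\<Sum>k. indicator (tree_level b (Suc k)) v) =
        (\<Sum>k\<in>{n}. indicator (tree_level b (Suc k)) v :: ennreal)"
      by (intro suminf_finite) (auto simp: tree_level_def)
    with n show ?thesis
      by simp
  qed
  have "(\<integral>\<^sup>+v. ?f v \<partial>count_space ?X) =
      (\<integral>\<^sup>+v. (\<Sum>k. ?f v * indicator (tree_level b (Suc k)) v) \<partial>count_space ?X)"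
    by (intro nn_integral_cong) (simp add: one)
  also have "\<dots> = (\<Sum>k. \<integral>\<^sup>+v. ?f v * indicator (tree_level b (Suc k)) v \<partial>count_space ?X)"
    by (intro nn_integral_suminf) simp
  also have "\<dots> = (\<Sum>k. \<Sum>v\<in>tree_level b (Suc k). ?f v)"
  proof (intro suminf_cong)
    fix k
    have "(\<integral>\<^sup>+v. ?f v * indicator (tree_level b (Suc k)) v \<partial>count_space ?X) =
        (\<integral>\<^sup>+v. ?f v * indicator (tree_level b (Suc k)) v \<partial>count_space (tree_level b (Suc k)))"
      using sub[of k] by (intro nn_integral_count_space_eq) (auto simp: indicator_def)
    also have "\<dots> = (\<Sum>v\<in>tree_level b (Suc k). ?f v)"
      by (subst nn_integral_count_space_finite) auto
    finally show "(\<integral>\<^sup>+v. ?f v * indicator (tree_level b (Suc k)) v \<partial>count_space ?X) =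
        (\<Sum>v\<in>tree_level b (Suc k). ?f v)" .
  qed
  finally show ?thesis
    by (simp add: field_cost_def)
qed

text \<open>In this form the norm can be compared with \<open>field_cost_eq_levels\<close> vertex by
  vertex.\<close>

lemma tree_norm_eq_levels:
  "tree_norm b h = (\<Sum>k. \<Sum>v\<in>tree_level b (Suc k). ennreal ((1 / real b) ^ Suc k * \<bar>h v\<bar>))"
  unfolding tree_norm_def
  by (intro suminf_cong) (simp add: sum_distrib_left sum_ennreal del: power_Suc)

lemma tree_norm_mono:
  assumes "\<And>v. \<bar>h v\<bar> \<le> \<bar>h' v\<bar>"
  shows "tree_norm b h \<le> tree_norm b h'"
  unfolding tree_norm_def
  by (intro suminf_le summableI ennreal_leI mult_left_mono sum_mono assms) simp

lemma tree_norm_add_le: "tree_norm b (\<lambda>v. h v + h' v) \<le> tree_norm b h + tree_norm b h'"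
proof -
  have "tree_norm b (\<lambda>v. h v + h' v) \<le>
      (\<Sum>k. ennreal ((1 / real b) ^ Suc k * (\<Sum>v\<in>tree_level b (Suc k). \<bar>h v\<bar>)) +
        ennreal ((1 / real b) ^ Suc k * (\<Sum>v\<in>tree_level b (Suc k). \<bar>h' v\<bar>)))"
    unfolding tree_norm_def
  proof (intro suminf_le summableI)
    fix k
    have "(\<Sum>v\<in>tree_level b (Suc k). \<bar>h v + h' v\<bar>) \<le>
        (\<Sum>v\<in>tree_level b (Suc k). \<bar>h v\<bar>) + (\<Sum>v\<in>tree_level b (Suc k). \<bar>h' v\<bar>)"
      unfolding sum.distrib[symmetric] by (intro sum_mono abs_triangle_ineq)
    then have "(1 / real b) ^ Suc k * (\<Sum>v\<in>tree_level b (Suc k). \<bar>h v + h' v\<bar>) \<le>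
        (1 / real b) ^ Suc k * ((\<Sum>v\<in>tree_level b (Suc k). \<bar>h v\<bar>) +
          (\<Sum>v\<in>tree_level b (Suc k). \<bar>h' v\<bar>))"
      by (intro mult_left_mono) auto
    then show "ennreal ((1 / real b) ^ Suc k * (\<Sum>v\<in>tree_level b (Suc k). \<bar>h v + h' v\<bar>)) \<le>
        ennreal ((1 / real b) ^ Suc k * (\<Sum>v\<in>tree_level b (Suc k). \<bar>h v\<bar>)) +
        ennreal ((1 / real b) ^ Suc k * (\<Sum>v\<in>tree_level b (Suc k). \<bar>h' v\<bar>))"
      by (subst ennreal_plus[symmetric])
         (auto simp: sum_nonneg distrib_left simp del: power_Suc ennreal_plus intro!: ennreal_leI)
  qed
  also have "\<dots> = tree_norm b h + tree_norm b h'"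
    unfolding tree_norm_def by (intro suminf_add[symmetric] summableI)
  finally show ?thesis .
qed

lemma tree_fields_add:
  assumes "h \<in> tree_fields b" "h' \<in> tree_fields b"
  shows "(\<lambda>v. h v + h' v) \<in> tree_fields b"
  using assms le_less_trans[OF tree_norm_add_le[of b h h']] by (simp add: tree_fields_def)

lemma tree_fields_scale:
  assumes "h \<in> tree_fields b" "\<bar>s\<bar> \<le> 1"
  shows "(\<lambda>v. s * h v) \<in> tree_fields b"
  using assms le_less_trans[OF tree_norm_mono[of "\<lambda>v. s * h v" h b]]
  by (simp add: tree_fields_def abs_mult mult_left_le_one_le)

section \<open>First-level fields and linearity of ray sums\<close>

definition level_one_field :: "(nat \<Rightarrow> real) \<Rightarrow> nat list \<Rightarrow> real" where
  "level_one_field f v = (if length v = 1 then f (hd v) else 0)"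

lemma ray_sum_level_one: "ray_sum (level_one_field f) \<xi> = f (\<xi> 1)"
  unfolding ray_sum_def
  by (subst suminf_finite[of "{0}"]) (auto simp: level_one_field_def hd_ray_prefix)

lemma level_one_field_level:
  "v \<in> tree_level b (Suc k) \<Longrightarrow> level_one_field f v = (if k = 0 then f (hd v) else 0)"
  by (auto simp: level_one_field_def tree_level_def)

lemma level_one_field_in_tree_fields: "level_one_field f \<in> tree_fields b"
proof -
  have "tree_norm b (level_one_field f) =
      (\<Sum>k\<in>{0}. ennreal ((1 / real b) ^ Suc k *
        (\<Sum>v\<in>tree_level b (Suc k). \<bar>level_one_field f v\<bar>)))"
    unfolding tree_norm_def by (intro suminf_finite) (auto simp: level_one_field_level)
  then show ?thesis
    by (simp add: tree_fields_def level_one_field_def less_top[symmetric])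
qed

lemma field_cost_level_one:
  "field_cost b \<alpha> lam (level_one_field f) = ennreal lam * ennreal (\<Sum>i=1..b. \<bar>f i\<bar> powr \<alpha>)"
proof -
  have "(\<Sum>k. \<Sum>v\<in>tree_level b (Suc k). ennreal (\<bar>level_one_field f v\<bar> powr \<alpha>)) =
      (\<Sum>k\<in>{0}. \<Sum>v\<in>tree_level b (Suc k). ennreal (\<bar>level_one_field f v\<bar> powr \<alpha>))"
    by (intro suminf_finite) (auto simp: level_one_field_level)
  then show ?thesis
    by (simp add: field_cost_eq_levels sum_tree_level_1 level_one_field_def sum_ennreal)
qed

text \<open>Linearity of \<open>suminf\<close> rests on summability, which holds on almost every
  ray.\<close>

lemma AE_ray_sum_scale:
  assumes "b > 0" "h \<in> tree_fields b"
  shows "AE \<xi> in boundary_measure b. ray_sum (\<lambda>v. s * h v) \<xi> = s * ray_sum h \<xi>"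
proof -
  have "AE \<xi> in boundary_measure b. summable (\<lambda>k. \<bar>h (ray_prefix \<xi> (Suc k))\<bar>)"
    using AE_summable_ray[of b h] assms by (simp add: tree_fields_def)
  then show ?thesis
    by eventually_elim (simp add: ray_sum_def suminf_mult summable_rabs_cancel)
qed

lemma AE_ray_sum_add:
  assumes "b > 0" "h \<in> tree_fields b" "h' \<in> tree_fields b"
  shows "AE \<xi> in boundary_measure b. ray_sum (\<lambda>v. h v + h' v) \<xi> = ray_sum h \<xi> + ray_sum h' \<xi>"
proof -
  have "AE \<xi> in boundary_measure b. summable (\<lambda>k. \<bar>h (ray_prefix \<xi> (Suc k))\<bar>)"
    "AE \<xi> in boundary_measure b. summable (\<lambda>k. \<bar>h' (ray_prefix \<xi> (Suc k))\<bar>)"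
    using AE_summable_ray[of b h] AE_summable_ray[of b h'] assms by (simp_all add: tree_fields_def)
  then show ?thesis
    by eventually_elim (simp add: ray_sum_def suminf_add summable_rabs_cancel)
qed

section \<open>Relaxed constraint and right continuity\<close>

context
  fixes b :: nat and A :: "real set"
  assumes b: "b > 0" and A: "finite (frontier A)"
begin

interpretation B: prob_space "boundary_measure b"
  by (rule prob_space_boundary[OF b])

lemma measurable_shifted_measure: "shifted_measure A \<in> borel_measurable borel"
  using isCont_shifted_measure[OF A]
  by (intro borel_measurable_continuous_onI) (simp add: continuous_at_imp_continuous_on)

lemma measurable_shifted_measure_comp:
  "X \<in> borel_measurable M \<Longrightarrow> (\<lambda>\<xi>. shifted_measure A (X \<xi>)) \<in> borel_measurable M"
  using measurable_shifted_measure by (rule measurable_compose_rev)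

lemma integrable_shifted_measure:
  assumes "X \<in> borel_measurable (boundary_measure b)"
  shows "integrable (boundary_measure b) (\<lambda>\<xi>. shifted_measure A (X \<xi>))"
  using assms
  by (intro B.integrable_const_bound[of _ 1])
     (auto simp: shifted_measure_nonneg shifted_measure_le_1 measurable_shifted_measure_comp)

text \<open>The first coordinate of a ray is uniform on \<open>{1..b}\<close>.\<close>

lemma mean_measure_level_one:
  "mean_measure b A (level_one_field f) = (1 / real b) * (\<Sum>i=1..b. shifted_measure A (f i))"
proof -
  have "mean_measure b A (level_one_field f) =
      (\<integral>\<xi>. shifted_measure A (f (hd (ray_prefix \<xi> (Suc 0)))) \<partial>boundary_measure b)"
    by (simp add: mean_measure_def ray_sum_level_one ray_prefix_1)
  also have "\<dots> = (1 / real b) * (\<Sum>i=1..b. shifted_measure A (f i))"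
    by (subst integral_ray_prefix[OF b, of "\<lambda>v. shifted_measure A (f (hd v))"])
       (simp add: sum_tree_level_1)
  finally show ?thesis .
qed

text \<open>Scaling \<open>h\<close> by a factor in \<open>[0,1]\<close> lowers its cost and moves its mean continuously
  from the Gaussian measure of \<open>A\<close> to that of \<open>h\<close>, so the constraint \<open>= q\<close> may be
  relaxed to \<open>\<ge> q\<close>.\<close>

lemma min_cost_le:
  assumes q: "measure gauss A \<le> q" "q \<le> mean_measure b A h"
    and h: "h \<in> tree_fields b" and "\<alpha> > 0"
  shows "min_cost b \<alpha> lam A q \<le> field_cost b \<alpha> lam h"
proof -
  let ?\<phi> = "\<lambda>s. \<integral>\<xi>. shifted_measure A (s * ray_sum h \<xi>) \<partial>boundary_measure b"
  note [measurable] = measurable_ray_sum[OF b]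
  \<comment> \<open>The integrands are bounded by 1, so continuity of
    \<open>shifted_measure A\<close> passes to the mean.\<close>
  have "isCont ?\<phi> s" for s
  proof -
    have "(\<lambda>n. ?\<phi> (S n)) \<longlonglongrightarrow> ?\<phi> s" if S: "S \<longlonglongrightarrow> s" for S
    proof (rule integral_dominated_convergence[where w = "\<lambda>_. 1"])
      show "AE \<xi> in boundary_measure b.
          (\<lambda>n. shifted_measure A (S n * ray_sum h \<xi>)) \<longlonglongrightarrow> shifted_measure A (s * ray_sum h \<xi>)"
        by (intro AE_I2 isCont_tendsto_compose[OF isCont_shifted_measure[OF A]] tendsto_intros S)
    qed (auto simp: shifted_measure_nonneg shifted_measure_le_1
        intro!: measurable_shifted_measure_comp)
    then show ?thesis
      by (simp add: continuous_at_sequentially o_def)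
  qed
  moreover have "?\<phi> 0 \<le> q" "q \<le> ?\<phi> 1"
    using q by (simp_all add: shifted_measure_0 mean_measure_def B.prob_space)
  ultimately obtain s where s: "0 \<le> s" "s \<le> 1" "?\<phi> s = q"
    using IVT[of ?\<phi> 0 q 1] by auto
  let ?h = "\<lambda>v. s * h v"
  have "mean_measure b A ?h = ?\<phi> s"
    unfolding mean_measure_def
  proof (rule integral_cong_AE)
    show "AE \<xi> in boundary_measure b.
        shifted_measure A (ray_sum ?h \<xi>) = shifted_measure A (s * ray_sum h \<xi>)"
      using AE_ray_sum_scale[OF b h, of s] by eventually_elim simp
  qed (auto intro!: measurable_shifted_measure_comp measurable_ray_sum[OF b])
  moreover have "?h \<in> tree_fields b"
    using s by (intro tree_fields_scale h) auto
  ultimately have "min_cost b \<alpha> lam A q \<le> field_cost b \<alpha> lam ?h"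
    unfolding min_cost_def using s by (intro INF_lower) simp
  also have "\<dots> \<le> field_cost b \<alpha> lam h"
    unfolding field_cost_def using s \<open>\<alpha> > 0\<close>
    by (intro mult_left_mono nn_integral_mono ennreal_leI powr_mono2)
       (auto simp: abs_mult mult_left_le_one_le)
  finally show ?thesis .
qed

text \<open>Every competitor for \<open>q'\<close> has mean at least \<open>q\<close>, so by
  \<open>min_cost_le\<close> its cost bounds the minimal cost at \<open>q\<close>.\<close>

lemma min_cost_mono:
  assumes "measure gauss A \<le> q" "q \<le> q'" "\<alpha> > 0"
  shows "min_cost b \<alpha> lam A q \<le> min_cost b \<alpha> lam A q'"
  unfolding min_cost_def[of b \<alpha> lam A q']
  using assms by (intro INF_greatest min_cost_le) auto

text \<open>Only the term of the vertex \<open>[1]\<close> changes. The additive form avoids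
  subtraction in \<open>ennreal\<close> and covers infinite cost as well.\<close>

lemma field_cost_level_one_perturb_le:
  assumes "lam \<ge> 0"
  shows "field_cost b \<alpha> lam (\<lambda>v. h v + level_one_field (\<lambda>i. if i = 1 then d else 0) v) \<le>
    field_cost b \<alpha> lam h + ennreal (lam * \<bar>\<bar>h [1] + d\<bar> powr \<alpha> - \<bar>h [1]\<bar> powr \<alpha>\<bar>)"
proof -
  let ?D = "\<bar>\<bar>h [1] + d\<bar> powr \<alpha> - \<bar>h [1]\<bar> powr \<alpha>\<bar>"
  let ?h = "\<lambda>v. h v + level_one_field (\<lambda>i. if i = 1 then d else 0) v"
  have "(\<integral>\<^sup>+v. ennreal (\<bar>?h v\<bar> powr \<alpha>) \<partial>count_space (tree b - {[]})) \<le>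
      (\<integral>\<^sup>+v. ennreal (\<bar>h v\<bar> powr \<alpha>) + ennreal ?D * indicator {[1]} v
        \<partial>count_space (tree b - {[]}))"
  proof (intro nn_integral_mono)
    fix v
    have "level_one_field (\<lambda>i. if i = 1 then d else 0) v = 0" if "v \<noteq> [1]"
      using that by (cases v) (auto simp: level_one_field_def)
    then consider "v = [1]" | "v \<noteq> [1]" "level_one_field (\<lambda>i. if i = 1 then d else 0) v = 0"
      by blast
    then show "ennreal (\<bar>?h v\<bar> powr \<alpha>) \<le>
        ennreal (\<bar>h v\<bar> powr \<alpha>) + ennreal ?D * indicator {[1]} v"
    proof cases
      case 1
      then show ?thesis
        by (auto simp: level_one_field_def ennreal_plus[symmetric] simp del: ennreal_plus
            intro!: ennreal_leI)
    qed simp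
  qed
  also have "\<dots> \<le> (\<integral>\<^sup>+v. ennreal (\<bar>h v\<bar> powr \<alpha>) \<partial>count_space (tree b - {[]})) + ennreal ?D"
  proof -
    have "[1] \<in> tree b - {[]}"
      using b by (auto simp: tree_def tree_level_def)
    then show ?thesis
      by (subst nn_integral_add) (auto simp: nn_integral_cmult_indicator)
  qed
  finally have "field_cost b \<alpha> lam ?h \<le> ennreal lam *
      ((\<integral>\<^sup>+v. ennreal (\<bar>h v\<bar> powr \<alpha>) \<partial>count_space (tree b - {[]})) + ennreal ?D)"
    unfolding field_cost_def by (intro mult_left_mono) auto
  then show ?thesis
    using assms by (simp add: field_cost_def distrib_left ennreal_mult)
qed

text \<open>Rays through \<open>[1]\<close> have mass \<open>1 / b\<close>, and on almost all of
  them the ray sum moves by \<open>\<sigma> * d\<close>, which strictly raises the measure; almost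
  all other rays keep their sum.\<close>

lemma mean_measure_level_one_perturb_less:
  assumes \<sigma>: "\<sigma> \<in> {-1, 1}" and mono: "strict_mono (\<lambda>t. shifted_measure A (\<sigma> * t))"
    and h: "h \<in> tree_fields b" and "d > 0"
  shows "mean_measure b A h <
    mean_measure b A (\<lambda>v. h v + level_one_field (\<lambda>i. if i = 1 then \<sigma> * d else 0) v)"
proof -
  let ?k = "level_one_field (\<lambda>i. if i = 1 then \<sigma> * d else 0)"
  let ?C = "{\<xi>\<in>space (boundary_measure b). ray_prefix \<xi> 1 = [1]}"
  note [measurable] = measurable_ray_sum[OF b]
  have less: "shifted_measure A x < shifted_measure A (x + \<sigma> * d)" for x
    using strict_monoD[OF mono, of "\<sigma> * x" "\<sigma> * x + d"] \<sigma> \<open>d > 0\<close> by auto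
  have ae: "AE \<xi> in boundary_measure b.
      ray_sum (\<lambda>v. h v + ?k v) \<xi> = ray_sum h \<xi> + (if \<xi> 1 = 1 then \<sigma> * d else 0)"
    using AE_ray_sum_add[OF b h level_one_field_in_tree_fields, of "\<lambda>i. if i = 1 then \<sigma> * d else 0"]
    by (simp add: ray_sum_level_one)
  have C: "[1] \<in> tree_level b 1"
    using b by (auto simp: tree_level_def)
  show ?thesis
    unfolding mean_measure_def
  proof (rule B.integral_less_AE[where A = ?C])
    show "emeasure (boundary_measure b) ?C \<noteq> 0"
      using emeasure_prefix_cylinder[OF b C] b by simp
    show "?C \<in> sets (boundary_measure b)"
      by (rule prefix_cylinder_sets[OF b C])
    show "AE \<xi> in boundary_measure b. \<xi> \<in> ?C \<longrightarrow>
        shifted_measure A (ray_sum h \<xi>) \<noteq> shifted_measure A (ray_sum (\<lambda>v. h v + ?k v) \<xi>)"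
      using ae by eventually_elim (auto simp: ray_prefix_1 less[THEN less_imp_neq])
    show "AE \<xi> in boundary_measure b.
        shifted_measure A (ray_sum h \<xi>) \<le> shifted_measure A (ray_sum (\<lambda>v. h v + ?k v) \<xi>)"
      using ae by eventually_elim (auto simp: less[THEN less_imp_le])
  qed (intro integrable_shifted_measure measurable_ray_sum[OF b])+
qed

lemma min_cost_right_continuous:
  assumes "\<alpha> > 0" "lam > 0" and \<sigma>: "\<sigma> \<in> {-1, 1}"
    and mono: "strict_mono (\<lambda>t. shifted_measure A (\<sigma> * t))"
    and p: "measure gauss A \<le> p"
  shows "(min_cost b \<alpha> lam A \<longlongrightarrow> min_cost b \<alpha> lam A p) (at_right p)"
proof (rule order_tendstoI)
  \<comment> \<open>From below, monotonicity suffices.\<close>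
  fix a assume "a < min_cost b \<alpha> lam A p"
  then have "a < min_cost b \<alpha> lam A q" if "p < q" for q
    using min_cost_mono[of p q] that p \<open>\<alpha> > 0\<close> by (meson less_imp_le less_le_trans)
  then show "eventually (\<lambda>q. a < min_cost b \<alpha> lam A q) (at_right p)"
    by (simp add: eventually_at_filter)
next
  \<comment> \<open>From above, a field of mean \<open>p\<close> and cost below \<open>c\<close> is
    moved slightly at \<open>[1]\<close>. Its mean then exceeds \<open>p\<close>, so its cost bounds
    \<open>min_cost\<close> at every \<open>q\<close> between \<open>p\<close> and that
    mean.\<close>
  fix c assume "min_cost b \<alpha> lam A p < c"
  then obtain h where h: "h \<in> tree_fields b" "mean_measure b A h = p" and c: "field_cost b \<alpha> lam h < c"
    by (auto simp: min_cost_def INF_less_iff)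
  let ?h = "\<lambda>d v. h v + level_one_field (\<lambda>i. if i = 1 then \<sigma> * d else 0) v"
  let ?D = "\<lambda>d. lam * \<bar>\<bar>h [1] + \<sigma> * d\<bar> powr \<alpha> - \<bar>h [1]\<bar> powr \<alpha>\<bar>"
  \<comment> \<open>The power is continuous, at 0 too because \<open>\<alpha> > 0\<close>, so the
    extra cost vanishes with \<open>d\<close>.\<close>
  have "(?D \<longlongrightarrow> lam * \<bar>\<bar>h [1] + \<sigma> * 0\<bar> powr \<alpha> - \<bar>h [1]\<bar> powr \<alpha>\<bar>) (at_right 0)"
    using \<open>\<alpha> > 0\<close> by (intro tendsto_intros tendsto_powr2) auto
  then have "((\<lambda>d. field_cost b \<alpha> lam h + ennreal (?D d)) \<longlongrightarrow> field_cost b \<alpha> lam h + ennreal 0) (at_right 0)"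
    by (intro tendsto_intros) simp
  then have "eventually (\<lambda>d. field_cost b \<alpha> lam h + ennreal (?D d) < c) (at_right 0)"
    using c by (intro order_tendstoD) auto
  then have "eventually (\<lambda>d. d > 0 \<and> field_cost b \<alpha> lam h + ennreal (?D d) < c) (at_right 0)"
    using eventually_at_right_less by eventually_elim simp
  then obtain d where d: "d > 0" "field_cost b \<alpha> lam h + ennreal (?D d) < c"
    using eventually_happens trivial_limit_at_right_real by blast
  have cost: "field_cost b \<alpha> lam (?h d) < c"
    using field_cost_level_one_perturb_le[of lam \<alpha> h "\<sigma> * d"] d \<open>lam > 0\<close> by simp
  have "?h d \<in> tree_fields b"
    by (intro tree_fields_add h level_one_field_in_tree_fields)
  then have "min_cost b \<alpha> lam A q < c" if "p < q" "q < mean_measure b A (?h d)" for q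
    using min_cost_le[of q "?h d" \<alpha> lam] that p \<open>\<alpha> > 0\<close> cost by fastforce
  moreover have "p < mean_measure b A (?h d)"
    using mean_measure_level_one_perturb_less[OF \<sigma> mono h(1) d(1)] h(2) by simp
  ultimately show "eventually (\<lambda>q. min_cost b \<alpha> lam A q < c) (at_right p)"
    by (auto simp: eventually_at_right_field)
qed

end

section \<open>Two inequalities for powers\<close>

text \<open>By convexity the power lies above its tangent at \<open>y\<close>. The terms are
  arranged so that all are nonnegative, ready for transfer to \<open>ennreal\<close>.\<close>

lemma powr_above_tangent:
  fixes x y \<alpha> :: real
  assumes "\<alpha> \<ge> 1" "x \<ge> 0" "y > 0"
  shows "y powr \<alpha> + \<alpha> * y powr (\<alpha> - 1) * x \<le> x powr \<alpha> + \<alpha> * y powr (\<alpha> - 1) * y"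
\<comment> \<open>The tangent argument runs on the open half-line; at \<open>x = 0\<close> the claim
  reduces to \<open>(\<alpha> - 1) * y powr \<alpha> \<ge> 0\<close>.\<close>
proof (cases "x = 0")
  case True
  have "y powr \<alpha> = y powr (\<alpha> - 1) * y"
    using assms powr_mult_base[of y "\<alpha> - 1"] by (simp add: mult.commute)
  moreover have "0 \<le> (\<alpha> - 1) * (y powr (\<alpha> - 1) * y)"
    using assms by simp
  ultimately show ?thesis
    using True by (simp add: algebra_simps)
next
  case False
  have "x powr \<alpha> - y powr \<alpha> \<ge> \<alpha> * y powr (\<alpha> - 1) * (x - y)"
  proof (rule convex_on_imp_above_tangent[OF powr_convex[OF \<open>\<alpha> \<ge> 1\<close>]])
    show "((\<lambda>x. x powr \<alpha>) has_real_derivative \<alpha> * y powr (\<alpha> - 1)) (at y within {0<..})"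
      using assms by (auto intro!: derivative_eq_intros)
  qed (use assms False in \<open>auto simp: interior_open\<close>)
  then show ?thesis
    by (simp add: algebra_simps)
qed

text \<open>This is the embedding of the sequence space of exponent \<alpha> into that of exponent
  1. With \<open>R = r powr (1 / \<alpha>)\<close> no term exceeds \<open>R\<close>, so
  \<open>a k\<close> is at most \<open>R powr (1 - \<alpha>) * a k powr \<alpha>\<close>, and
  summing gives at most \<open>R\<close>.\<close>

lemma suminf_le_powr_suminf_powr:
  fixes a :: "nat \<Rightarrow> real"
  assumes \<alpha>: "0 < \<alpha>" "\<alpha> \<le> 1" and a: "\<And>k. 0 \<le> a k" and "0 \<le> r"
    and sum: "(\<Sum>k. ennreal (a k powr \<alpha>)) \<le> ennreal r"
  shows "(\<Sum>k. ennreal (a k)) \<le> ennreal (r powr (1 / \<alpha>))"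
proof -
  define R where "R = r powr (1 / \<alpha>)"
  have R: "0 \<le> R" "R powr \<alpha> = r"
    using \<alpha> \<open>0 \<le> r\<close> by (auto simp: R_def powr_powr)
  have le: "a k \<le> R powr (1 - \<alpha>) * a k powr \<alpha>" for k
  proof -
    have "ennreal (a k powr \<alpha>) = (\<Sum>j\<in>{k}. ennreal (a j powr \<alpha>))"
      by simp
    also have "\<dots> \<le> (\<Sum>j. ennreal (a j powr \<alpha>))"
      by (intro sum_le_suminf summableI) auto
    finally have "a k powr \<alpha> \<le> r"
      using sum \<open>0 \<le> r\<close> by (metis ennreal_le_iff order_trans)
    then have "(a k powr \<alpha>) powr (1 / \<alpha>) \<le> R"
      unfolding R_def using \<alpha> by (intro powr_mono2) auto
    then have "a k \<le> R"
      using \<alpha> a[of k] by (simp add: powr_powr)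
    then have "a k powr (1 - \<alpha>) * a k powr \<alpha> \<le> R powr (1 - \<alpha>) * a k powr \<alpha>"
      using \<alpha> a[of k] by (intro mult_right_mono powr_mono2) auto
    then show ?thesis
      using a[of k] by (simp add: powr_add[symmetric])
  qed
  have "(\<Sum>k. ennreal (a k)) \<le> (\<Sum>k. ennreal (R powr (1 - \<alpha>)) * ennreal (a k powr \<alpha>))"
    by (intro suminf_le summableI) (simp add: ennreal_mult[symmetric] ennreal_leI le)
  also have "\<dots> = ennreal (R powr (1 - \<alpha>)) * (\<Sum>k. ennreal (a k powr \<alpha>))"
    by (rule ennreal_suminf_cmult)
  also have "\<dots> \<le> ennreal (R powr (1 - \<alpha>)) * ennreal r"
    by (intro mult_left_mono sum) simp
  also have "\<dots> = ennreal (R powr (1 - \<alpha>) * R powr \<alpha>)"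
    using R \<open>0 \<le> r\<close> by (simp add: ennreal_mult)
  also have "R powr (1 - \<alpha>) * R powr \<alpha> = R"
    using R(1) by (simp add: powr_add[symmetric])
  finally show ?thesis
    unfolding R_def .
qed

section \<open>Radial fields and the least cost for a given norm\<close>

definition radial_field :: "(nat \<Rightarrow> real) \<Rightarrow> nat list \<Rightarrow> real" where
  "radial_field f v = (if v = [] then 0 else f (length v))"

lemma radial_field_level: "v \<in> tree_level b (Suc k) \<Longrightarrow> radial_field f v = f (Suc k)"
  by (auto simp: radial_field_def tree_level_def)

lemma ray_sum_radial: "ray_sum (radial_field f) \<xi> = (\<Sum>k. f (Suc k))"
  unfolding ray_sum_def radial_field_def using length_ray_prefix[of \<xi> "Suc _"]
  by (metis length_0_conv nat.distinct(1))

lemma tree_norm_radial: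
  assumes "b > 0"
  shows "tree_norm b (radial_field f) = (\<Sum>k. ennreal \<bar>f (Suc k)\<bar>)"
  unfolding tree_norm_def using assms
  by (simp add: radial_field_level card_tree_level power_one_over del: power_Suc)

lemma field_cost_radial:
  "field_cost b \<alpha> lam (radial_field f) =
    ennreal lam * (\<Sum>k. ennreal (real b ^ Suc k * \<bar>f (Suc k)\<bar> powr \<alpha>))"
  unfolding field_cost_eq_levels
  by (simp add: radial_field_level card_tree_level sum_ennreal ennreal_mult ennreal_of_nat_eq_real_of_nat
      del: power_Suc flip: of_nat_power)

text \<open>In the concave case the infimum for \<open>\<alpha> > 1\<close> is attained at the radial field
  with entries \<open>T * c * q ^ k\<close> on level \<open>k\<close>, which is the equality case of the Hoelder
  inequality between \<open>tree_norm\<close> and the cost.\<close>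

context
  fixes b :: nat and \<alpha> T c q :: real
  assumes b: "b \<ge> 2" and \<alpha>: "\<alpha> > 1" and T: "T > 0"
    and q_def: "q = real b powr (- (1 / (\<alpha> - 1)))"
    and c_def: "c = real b powr (1 / (\<alpha> - 1)) - 1"
begin

lemma holder_q: "0 < q" "q < 1" "c > 0" "c * q = 1 - q"
proof -
  show q0: "0 < q"
    using b by (simp add: q_def)
  show "q < 1"
    using b \<alpha> by (simp add: q_def powr_less_one)
  show "c > 0"
    using b \<alpha> by (simp add: c_def)
  \<comment> \<open>In other words, \<open>c = 1 / q - 1\<close>.\<close>
  have "real b powr (1 / (\<alpha> - 1)) * q = 1"
    using b by (simp add: q_def powr_add[symmetric])
  then show "c * q = 1 - q"
    by (simp add: c_def algebra_simps)
qed

lemma holder_geometric_sums: "(\<lambda>k. q ^ Suc k) sums (1 / c)"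
proof -
  have "(\<lambda>k. q * q ^ k) sums (q * (1 / (1 - q)))"
    using holder_q by (intro sums_mult geometric_sums) auto
  moreover have "q * (1 / (1 - q)) = 1 / c"
    using holder_q by (simp add: field_simps)
  ultimately show ?thesis
    by simp
qed

text \<open>The factor \<open>c\<close> is the normalisation for which the entries along a ray add
  up to \<open>T\<close>.\<close>

lemma holder_field_sums: "(\<lambda>k. T * c * q ^ Suc k) sums T"
  using sums_mult[OF holder_geometric_sums, of "T * c"] holder_q by simp

text \<open>The ratio \<open>q\<close> is chosen for this identity: the derivative of the power at
  the entry of level \<open>n\<close> becomes proportional to the weight of that level in
  \<open>tree_norm\<close>, which is the Lagrange condition for the optimum.\<close>

lemma holder_q_power: "(q ^ n) powr (\<alpha> - 1) = (1 / real b) ^ n"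
proof -
  have "(q ^ n) powr (\<alpha> - 1) = (q powr (\<alpha> - 1)) ^ n"
    using holder_q by (simp add: powr_realpow[symmetric] powr_powr mult.commute)
  moreover have "q powr (\<alpha> - 1) = 1 / real b"
    using b \<alpha> unfolding q_def by (subst powr_powr) (simp add: powr_minus_divide)
  ultimately show ?thesis
    by simp
qed

lemma holder_field_powr_pred:
  "(T * c * q ^ n) powr (\<alpha> - 1) = (T * c) powr (\<alpha> - 1) * (1 / real b) ^ n"
  using holder_q T by (simp add: powr_mult holder_q_power)

text \<open>Multiplied by the number of vertices of its level, the cost of an entry is again
  geometric with ratio \<open>q\<close>, so the total cost is a geometric series.\<close>

lemma holder_field_powr: "real b ^ n * (T * c * q ^ n) powr \<alpha> = (T * c) powr \<alpha> * q ^ n"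
proof -
  have "(T * c * q ^ n) powr \<alpha> = (T * c * q ^ n) * (T * c * q ^ n) powr (\<alpha> - 1)"
    using powr_mult_base[of "T * c * q ^ n" "\<alpha> - 1"] holder_q T by simp
  also have "\<dots> = (T * c * (T * c) powr (\<alpha> - 1)) * q ^ n * (1 / real b) ^ n"
    unfolding holder_field_powr_pred by (simp only: mult_ac)
  also have "T * c * (T * c) powr (\<alpha> - 1) = (T * c) powr \<alpha>"
    using powr_mult_base[of "T * c" "\<alpha> - 1"] holder_q T by simp
  finally show ?thesis
    using b by (simp add: power_one_over field_simps)
qed

lemma holder_cost_sum:
  "(\<Sum>k. ennreal (real b ^ Suc k * (T * c * q ^ Suc k) powr \<alpha>)) =
    ennreal (c powr (\<alpha> - 1) * T powr \<alpha>)"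
proof -
  have "(\<lambda>k. (T * c) powr \<alpha> * q ^ Suc k) sums ((T * c) powr \<alpha> * (1 / c))"
    by (intro sums_mult holder_geometric_sums)
  moreover have "(T * c) powr \<alpha> * (1 / c) = c powr (\<alpha> - 1) * T powr \<alpha>"
    using holder_q T by (simp add: powr_mult powr_diff)
  ultimately show ?thesis
    unfolding holder_field_powr using holder_q
    by (intro suminf_ennreal_eq) auto
qed

lemma field_cost_holder_field:
  assumes "\<bar>s\<bar> = 1" "lam \<ge> 0"
  shows "field_cost b \<alpha> lam (radial_field (\<lambda>n. s * (T * c * q ^ n))) =
    ennreal (lam * c powr (\<alpha> - 1) * T powr \<alpha>)"
proof -
  have "\<bar>s * (T * c * q ^ Suc k)\<bar> = T * c * q ^ Suc k" for k
    unfolding abs_mult[of s] using assms holder_q T by (simp add: abs_mult)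
  then show ?thesis
    using assms by (simp only: field_cost_radial holder_cost_sum) (simp add: ennreal_mult mult.assoc)
qed

text \<open>Instead of the Hoelder inequality, the tangent line inequality is summed at the optimal
  field; since \<open>T * c * q ^ n\<close> raised to \<open>\<alpha> - 1\<close> is a multiple of \<open>b ^ (- n)\<close>,
  the linear terms add up to multiples of the tree norm.\<close>

lemma field_cost_ge_of_tree_norm_ge:
  assumes norm: "ennreal T \<le> tree_norm b h" and "lam \<ge> 0"
  shows "ennreal (lam * c powr (\<alpha> - 1) * T powr \<alpha>) \<le> field_cost b \<alpha> lam h"
proof -
  \<comment> \<open>\<open>K\<close> times the level weight is the slope of the tangent at
    \<open>y n\<close>, the optimal entry on level \<open>n\<close>.\<close>
  define K where "K = \<alpha> * (T * c) powr (\<alpha> - 1)"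
  define y where "y n = T * c * q ^ n" for n
  let ?N = "\<Sum>k. \<Sum>v\<in>tree_level b (Suc k). ennreal (\<bar>h v\<bar> powr \<alpha>)"
  have K: "K \<ge> 0"
    using \<alpha> by (simp add: K_def)
  have y: "y n > 0" for n
    using T holder_q by (simp add: y_def)
  have tangent: "y n powr \<alpha> + K * ((1 / real b) ^ n * x) \<le> x powr \<alpha> + K * ((1 / real b) ^ n * y n)"
    if "x \<ge> 0" for n x
    using powr_above_tangent[of \<alpha> x "y n"] \<alpha> that y[of n]
    unfolding y_def holder_field_powr_pred K_def by (simp add: mult.assoc)
  have level: "(\<Sum>v\<in>tree_level b n. ennreal u) = ennreal (real b ^ n * u)" if "u \<ge> 0" for n u
    using that by (simp add: card_tree_level ennreal_mult ennreal_of_nat_eq_real_of_nat)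
  \<comment> \<open>\<open>opt\<close> and \<open>lin\<close> evaluate the cost, without the factor
    \<open>lam\<close>, and the norm of the optimal field.\<close>
  have opt: "(\<Sum>k. \<Sum>v\<in>tree_level b (Suc k). ennreal (y (Suc k) powr \<alpha>)) =
      ennreal (c powr (\<alpha> - 1) * T powr \<alpha>)"
    unfolding level[OF powr_ge_zero] using holder_cost_sum by (simp add: y_def del: power_Suc)
  have lin: "(\<Sum>k. \<Sum>v\<in>tree_level b (Suc k). ennreal ((1 / real b) ^ Suc k * y (Suc k))) = ennreal T"
  proof -
    have "(\<Sum>v\<in>tree_level b (Suc k). ennreal ((1 / real b) ^ Suc k * y (Suc k))) =
        ennreal (T * c * q ^ Suc k)" for k
      using b y[of "Suc k"] by (subst level) (auto simp: y_def power_one_over simp del: power_Suc)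
    then show ?thesis
      using holder_field_sums holder_q T by (simp only:) (intro suminf_ennreal_eq, auto)
  qed
  have "ennreal (c powr (\<alpha> - 1) * T powr \<alpha>) + ennreal K * tree_norm b h =
      (\<Sum>k. \<Sum>v\<in>tree_level b (Suc k). ennreal (y (Suc k) powr \<alpha>) +
        ennreal K * ennreal ((1 / real b) ^ Suc k * \<bar>h v\<bar>))"
    unfolding sum.distrib sum_distrib_left[symmetric]
    by (simp only: suminf_add[OF summableI summableI, symmetric] ennreal_suminf_cmult opt
        tree_norm_eq_levels)
  also have "\<dots> \<le> (\<Sum>k. \<Sum>v\<in>tree_level b (Suc k). ennreal (\<bar>h v\<bar> powr \<alpha>) +
        ennreal K * ennreal ((1 / real b) ^ Suc k * y (Suc k)))"
  proof (intro suminf_le sum_mono summableI)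
    fix k v
    show "ennreal (y (Suc k) powr \<alpha>) + ennreal K * ennreal ((1 / real b) ^ Suc k * \<bar>h v\<bar>) \<le>
        ennreal (\<bar>h v\<bar> powr \<alpha>) + ennreal K * ennreal ((1 / real b) ^ Suc k * y (Suc k))"
      using tangent[of "\<bar>h v\<bar>" "Suc k"] K y[of "Suc k"]
      by (simp add: ennreal_mult[symmetric] ennreal_plus[symmetric] ennreal_leI
          del: power_Suc ennreal_plus)
  qed
  also have "\<dots> = ?N + ennreal K * ennreal T"
    unfolding sum.distrib sum_distrib_left[symmetric]
    by (simp only: suminf_add[OF summableI summableI, symmetric] ennreal_suminf_cmult lin)
  finally have "ennreal (c powr (\<alpha> - 1) * T powr \<alpha>) + ennreal K * tree_norm b h \<le>
      ?N + ennreal K * ennreal T" .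
  moreover have "ennreal (c powr (\<alpha> - 1) * T powr \<alpha>) + ennreal K * ennreal T \<le>
      ennreal (c powr (\<alpha> - 1) * T powr \<alpha>) + ennreal K * tree_norm b h"
    using norm by (intro add_left_mono mult_left_mono) auto
  ultimately have "ennreal K * ennreal T + ennreal (c powr (\<alpha> - 1) * T powr \<alpha>) \<le>
      ennreal K * ennreal T + ?N"
    unfolding add.commute[of "ennreal K * ennreal T"] by (rule order_trans[rotated])
  \<comment> \<open>The summand \<open>K * T\<close> is finite and can therefore be cancelled in
    \<open>ennreal\<close>.\<close>
  then have "ennreal (c powr (\<alpha> - 1) * T powr \<alpha>) \<le> ?N"
    unfolding ennreal_add_left_cancel_le by (auto simp: ennreal_mult[symmetric] K T less_imp_le)
  then have "ennreal lam * ennreal (c powr (\<alpha> - 1) * T powr \<alpha>) \<le> ennreal lam * ?N"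
    by (intro mult_left_mono) auto
  then show ?thesis
    using \<open>lam \<ge> 0\<close> by (simp add: field_cost_eq_levels ennreal_mult mult.assoc)
qed

end

text \<open>A nonroot vertex has weight at most \<open>1 / b\<close> in \<open>tree_norm\<close>,
  with equality on the first level.\<close>

lemma field_cost_ge_of_tree_norm_ge_1:
  assumes "b > 0" "T \<ge> 0" "ennreal T \<le> tree_norm b h" "lam \<ge> 0"
  shows "ennreal (lam * real b * T) \<le> field_cost b 1 lam h"
proof -
  let ?N = "\<Sum>k. \<Sum>v\<in>tree_level b (Suc k). ennreal (\<bar>h v\<bar> powr 1)"
  have "ennreal (real b) * ennreal T \<le> ennreal (real b) * tree_norm b h"
    using assms by (intro mult_left_mono) auto
  also have "\<dots> = (\<Sum>k. \<Sum>v\<in>tree_level b (Suc k).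
      ennreal (real b) * ennreal ((1 / real b) ^ Suc k * \<bar>h v\<bar>))"
    unfolding tree_norm_eq_levels sum_distrib_left[symmetric] by simp
  also have "\<dots> \<le> ?N"
  proof (intro suminf_le sum_mono summableI)
    fix k v
    have "real b * ((1 / real b) ^ Suc k * \<bar>h v\<bar>) = (1 / real b) ^ k * \<bar>h v\<bar>"
      using \<open>b > 0\<close> by simp
    also have "\<dots> \<le> \<bar>h v\<bar>"
      using \<open>b > 0\<close> by (intro mult_left_le_one_le power_le_one) auto
    finally show "ennreal (real b) * ennreal ((1 / real b) ^ Suc k * \<bar>h v\<bar>) \<le> ennreal (\<bar>h v\<bar> powr 1)"
      by (simp add: ennreal_mult[symmetric] ennreal_leI del: power_Suc)
  qed
  finally have "ennreal lam * (ennreal (real b) * ennreal T) \<le> ennreal lam * ?N"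
    by (intro mult_left_mono) auto
  then show ?thesis
    using assms by (simp add: field_cost_eq_levels ennreal_mult mult.assoc)
qed

section \<open>Shifts in the increasing direction\<close>

context
  fixes b :: nat and A :: "real set" and \<sigma> :: real
  assumes b: "b \<ge> 2" and A: "finite (frontier A)"
    and \<sigma>: "\<sigma> \<in> {-1, 1}" and mono: "strict_mono (\<lambda>t. shifted_measure A (\<sigma> * t))"
begin

lemma b_pos: "b > 0"
  using b by simp

interpretation B: prob_space "boundary_measure b"
  by (rule prob_space_boundary[OF b_pos])

lemma sign_mult_cancel: "\<sigma> * (\<sigma> * x) = x"
  using \<sigma> by auto

lemma shifted_measure_le_abs:
  assumes "\<bar>x\<bar> \<le> t"
  shows "shifted_measure A x \<le> shifted_measure A (\<sigma> * t)"
proof -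
  have "\<sigma> * x \<le> t"
    using assms \<sigma> by auto
  then show ?thesis
    using strict_mono_mono[OF mono, THEN monoD, of "\<sigma> * x" t] by (simp add: sign_mult_cancel)
qed

text \<open>Some shift has measure above \<open>p\<close>, as \<open>p\<close> is below the
  supremum. Monotonicity places it on the positive side in direction \<open>\<sigma>\<close>, and
  the intermediate value theorem gives \<open>T\<close>.\<close>

lemma ex_shift_eq:
  assumes "measure gauss A < p" "p < sup_shifted_measure A"
  obtains T where "T > 0" "shifted_measure A (\<sigma> * T) = p"
proof -
  let ?G = "\<lambda>t. shifted_measure A (\<sigma> * t)"
  have "bdd_above (range (shifted_measure A))"
    by (intro bdd_aboveI[of _ 1]) (auto simp: shifted_measure_le_1)
  then obtain x where x: "p < shifted_measure A x"
    using assms(2) by (auto simp: sup_shifted_measure_def less_cSUP_iff)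
  then have "p < ?G (\<sigma> * x)"
    by (simp add: sign_mult_cancel)
  moreover have "?G 0 < p"
    using assms(1) by (simp add: shifted_measure_0)
  ultimately have "0 < \<sigma> * x"
    using strict_mono_less[OF mono, of 0 "\<sigma> * x"] by linarith
  moreover have "isCont ?G t" for t
    by (intro isCont_o2[OF _ isCont_shifted_measure[OF A]] continuous_intros)
  ultimately obtain T where "0 \<le> T" "?G T = p"
    using IVT[of ?G 0 p "\<sigma> * x"] \<open>?G 0 < p\<close> \<open>p < ?G (\<sigma> * x)\<close> by auto
  moreover from this have "T \<noteq> 0"
    using \<open>?G 0 < p\<close> by auto
  ultimately show thesis
    using that[of T] by simp
qed

text \<open>By strict monotonicity the admissible shifts are those with
  \<open>\<sigma> * x \<ge> T\<close>, and \<open>\<sigma> * T\<close> is the one nearest to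
  0.\<close>

lemma min_shift_eq:
  assumes "T > 0" "shifted_measure A (\<sigma> * T) = p"
  shows "min_shift A p = T"
  unfolding min_shift_def
proof (rule cInf_eq_minimum)
  show "T \<in> {\<bar>x\<bar> |x. p \<le> shifted_measure A x}"
    using assms \<sigma> by (auto intro!: exI[of _ "\<sigma> * T"] simp: abs_mult)
next
  fix y assume "y \<in> {\<bar>x\<bar> |x. p \<le> shifted_measure A x}"
  then obtain x where x: "y = \<bar>x\<bar>" "shifted_measure A (\<sigma> * T) \<le> shifted_measure A (\<sigma> * (\<sigma> * x))"
    using assms by (auto simp: sign_mult_cancel)
  then have "T \<le> \<sigma> * x"
    using strict_mono_less_eq[OF mono] by blast
  then show "T \<le> y"
    using x \<sigma> by auto
qed

section \<open>Reduction to one level\<close>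

text \<open>The constant vector \<open>T\<close> is admissible at cost \<open>C\<close>, so only
  vectors of cost at most \<open>C\<close> compete. Their entries are at most \<open>R\<close>, and
  on the resulting compact set the continuous cost attains its minimum.\<close>

lemma one_level_costs_min:
  assumes "\<alpha> > 0" "T \<ge> 0" "p \<le> shifted_measure A (\<sigma> * T)"
  obtains m where "m \<in> one_level_costs b \<alpha> A \<sigma> p" "\<And>s. s \<in> one_level_costs b \<alpha> A \<sigma> p \<Longrightarrow> m \<le> s"
proof -
  let ?mean = "\<lambda>t. (1 / real b) * (\<Sum>i=1..b. shifted_measure A (\<sigma> * t i))"
  let ?cost = "\<lambda>t :: nat \<Rightarrow> real. \<Sum>i=1..b. t i powr \<alpha>"
  define C where "C = real b * T powr \<alpha>"
  define R where "R = C powr (1 / \<alpha>)"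
  \<comment> \<open>Vectors are functions on all of \<open>nat\<close>; fixing the value 0 outside
    \<open>{1..b}\<close> makes the box compact in the product topology.\<close>
  define Bx where "Bx = (\<Pi>\<^sub>E i\<in>UNIV. if i \<in> {1..b} then {0..R} else {0})"
  define K where "K = Bx \<inter> {t. p \<le> ?mean t}"
  have Bx: "t \<in> Bx \<longleftrightarrow> (\<forall>i. if i \<in> {1..b} then 0 \<le> t i \<and> t i \<le> R else t i = 0)" for t
    unfolding Bx_def PiE_UNIV_domain Pi_iff by (auto split: if_splits)
  have "compact Bx"
    unfolding Bx_def compactin_euclidean_iff[symmetric] euclidean_product_topology[symmetric]
    by (subst compactin_PiE) auto
  moreover have "closed {t. p \<le> ?mean t}"
  proof (intro closed_Collect_le continuous_intros continuous_on_sum)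
    fix i :: nat
    have "continuous_on UNIV (shifted_measure A)"
      using isCont_shifted_measure[OF A] by (simp add: continuous_at_imp_continuous_on)
    then show "continuous_on UNIV (\<lambda>t. shifted_measure A (\<sigma> * t i))"
      by (rule continuous_on_compose2) (auto intro!: continuous_intros)
  qed
  ultimately have "compact K"
    unfolding K_def by (rule compact_Int_closed)
  have inK: "(\<lambda>i. if i \<in> {1..b} then t i else 0) \<in> K"
    if t: "\<forall>i\<in>{1..b}. 0 \<le> t i" "p \<le> ?mean t" "?cost t \<le> C" for t
  proof -
    have "t i \<le> R" if "i \<in> {1..b}" for i
    proof -
      have "t i powr \<alpha> \<le> ?cost t"
        using that by (intro member_le_sum) auto
      then have "(t i powr \<alpha>) powr (1 / \<alpha>) \<le> R"
        unfolding R_def using t \<open>\<alpha> > 0\<close> by (intro powr_mono2) auto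
      then show ?thesis
        using \<open>\<alpha> > 0\<close> t(1) that by (simp add: powr_powr)
    qed
    then show ?thesis
      using t by (auto simp: K_def Bx)
  qed
  have feas: "\<forall>i\<in>{1..b}. 0 \<le> T" "p \<le> ?mean (\<lambda>_. T)" "?cost (\<lambda>_. T) = C"
    using assms b_pos by (auto simp: C_def)
  then have "(\<lambda>i. if i \<in> {1..b} then T else 0) \<in> K"
    using inK[of "\<lambda>_. T"] by simp
  moreover have "continuous_on K ?cost"
  proof (intro continuous_on_sum continuous_on_powr' continuous_intros)
    fix i :: nat
    show "continuous_on K (\<lambda>t. t i)"
      by (rule continuous_on_subset[OF continuous_on_product_coordinates]) simp
  qed (use \<open>\<alpha> > 0\<close> in \<open>auto simp: K_def Bx\<close>)
  ultimately obtain t where t: "t \<in> K" "\<And>t'. t' \<in> K \<Longrightarrow> ?cost t \<le> ?cost t'"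
    using continuous_attains_inf[OF \<open>compact K\<close>, of ?cost] by blast
  have cut: "?cost (\<lambda>i. if i \<in> {1..b} then t' i else 0) = ?cost t'" for t'
    by (intro sum.cong) auto
  show thesis
  proof (rule that[of "?cost t"])
    show "?cost t \<in> one_level_costs b \<alpha> A \<sigma> p"
      using t(1) unfolding one_level_costs_def by (auto simp: K_def Bx intro!: exI[of _ t])
    fix s assume "s \<in> one_level_costs b \<alpha> A \<sigma> p"
    then obtain t' where t': "s = ?cost t'" "\<forall>i\<in>{1..b}. 0 \<le> t' i" "p \<le> ?mean t'"
      by (auto simp: one_level_costs_def)
    \<comment> \<open>A vector costlier than \<open>C\<close> loses against the constant
      \<open>T\<close>; any other has a truncation of the same cost in \<open>K\<close>.\<close>
    show "?cost t \<le> s"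
    proof (cases "s \<le> C")
      case True
      then show ?thesis
        using t(2)[OF inK[of t']] t' cut[of t'] by simp
    next
      case False
      have "?cost t \<le> C"
        using t(2)[OF inK[of "\<lambda>_. T"]] feas cut[of "\<lambda>_. T"] by simp
      with False show ?thesis
        by simp
    qed
  qed
qed

text \<open>The first-level field with entries \<open>\<sigma> * t i\<close> has mean at least
  \<open>p\<close>, which is enough for \<open>min_cost_le\<close>.\<close>

lemma min_cost_le_one_level:
  assumes "\<alpha> > 0" "lam \<ge> 0" "measure gauss A \<le> p" and s: "s \<in> one_level_costs b \<alpha> A \<sigma> p"
  shows "min_cost b \<alpha> lam A p \<le> ennreal (lam * s)"
proof -
  obtain t where t: "s = (\<Sum>i=1..b. t i powr \<alpha>)" "\<forall>i\<in>{1..b}. t i \<ge> 0"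
    "(1 / real b) * (\<Sum>i=1..b. shifted_measure A (\<sigma> * t i)) \<ge> p"
    using s by (auto simp: one_level_costs_def)
  have "min_cost b \<alpha> lam A p \<le> field_cost b \<alpha> lam (level_one_field (\<lambda>i. \<sigma> * t i))"
    using assms t b_pos
    by (intro min_cost_le[OF b_pos A] level_one_field_in_tree_fields)
       (auto simp: mean_measure_level_one[OF b_pos A])
  also have "(\<Sum>i=1..b. \<bar>\<sigma> * t i\<bar> powr \<alpha>) = s"
    unfolding t(1) using t(2) \<sigma> by (intro sum.cong) (auto simp: abs_mult)
  then have "field_cost b \<alpha> lam (level_one_field (\<lambda>i. \<sigma> * t i)) = ennreal (lam * s)"
    using assms t by (simp add: field_cost_level_one ennreal_mult sum_nonneg)
  finally show ?thesis .
qed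

text \<open>For \<open>\<alpha> \<le> 1\<close> nothing is lost by collapsing the subtree below a vertex \<open>[i]\<close> to a single
  value \<open>t i\<close> with \<open>t i powr \<alpha>\<close> the cost of that subtree, as \<open>t i\<close> dominates
  the sum of the field along any ray of the subtree.\<close>

lemma field_cost_ge_one_level:
  assumes \<alpha>: "0 < \<alpha>" "\<alpha> \<le> 1" and "lam > 0" and h: "h \<in> tree_fields b"
    and fin: "field_cost b \<alpha> lam h < \<infinity>"
  obtains s where "s \<in> one_level_costs b \<alpha> A \<sigma> (mean_measure b A h)"
    "ennreal (lam * s) \<le> field_cost b \<alpha> lam h"
proof -
  let ?X = "count_space (tree b - {[]})"
  let ?f = "\<lambda>v. ennreal (\<bar>h v\<bar> powr \<alpha>)"
  \<comment> \<open>This is the cost of the subtree rooted at \<open>[i]\<close>, without the factor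
    \<open>lam\<close>.\<close>
  define C where "C i = (\<integral>\<^sup>+v. ?f v * indicator {v. hd v = i} v \<partial>?X)" for i
  define N where "N = (\<integral>\<^sup>+v. ?f v \<partial>?X)"
  define t where "t i = enn2real (C i) powr (1 / \<alpha>)" for i
  have cost: "field_cost b \<alpha> lam h = ennreal lam * N"
    by (simp add: field_cost_def N_def)
  have "N \<noteq> \<infinity>"
    using fin \<open>lam > 0\<close> unfolding cost by (auto simp: ennreal_mult_top)
  have "C i \<le> N" for i
    unfolding C_def N_def by (intro nn_integral_mono) (auto simp: indicator_def)
  then have "C i \<noteq> \<infinity>" for i
    using \<open>N \<noteq> \<infinity>\<close> by (metis infinity_ennreal_def neq_top_trans)
  then have C: "ennreal (enn2real (C i)) = C i" for i
    by (simp add: less_top)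
  have "(\<Sum>i=1..b. C i) = (\<integral>\<^sup>+v. (\<Sum>i=1..b. ?f v * indicator {v. hd v = i} v) \<partial>?X)"
    unfolding C_def by (subst nn_integral_sum) auto
  also have "\<dots> \<le> N"
    unfolding N_def
  proof (intro nn_integral_mono)
    fix v
    \<comment> \<open>A vertex belongs to at most one of these subtrees.\<close>
    have "(\<Sum>i=1..b. indicator {v. hd v = i} v) \<le> (1 :: ennreal)"
      using card_mono[of "{hd v}" "{1..b} \<inter> {hd v}"] by (simp add: indicator_def)
    then have "?f v * (\<Sum>i=1..b. indicator {v. hd v = i} v) \<le> ?f v * 1"
      by (intro mult_left_mono) auto
    then show "(\<Sum>i=1..b. ?f v * indicator {v. hd v = i} v) \<le> ?f v"
      by (simp only: sum_distrib_left mult_1_right)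
  qed
  finally have CN: "(\<Sum>i=1..b. C i) \<le> N" .
  define s where "s = (\<Sum>i=1..b. t i powr \<alpha>)"
  have "t i powr \<alpha> = enn2real (C i)" for i
    using \<alpha> by (simp add: t_def powr_powr)
  then have "ennreal s = (\<Sum>i=1..b. C i)"
    unfolding s_def using C by (simp add: sum_ennreal[symmetric])
  then have "ennreal (lam * s) \<le> field_cost b \<alpha> lam h"
    unfolding cost using CN \<open>lam > 0\<close> by (simp add: ennreal_mult s_def sum_nonneg mult_left_mono)
  \<comment> \<open>The vertices of a ray are distinct and share their first letter, so their power
    sum is part of \<open>C (\<xi> 1)\<close>; \<open>suminf_le_powr_suminf_powr\<close> turns this
    into a bound on the sum itself.\<close>
  moreover have ray: "ray_abs_sum h \<xi> \<le> ennreal (t (\<xi> 1))" if \<xi>: "\<xi> \<in> space (boundary_measure b)" for \<xi>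
  proof -
    let ?e = "\<lambda>k. ray_prefix \<xi> (Suc k)"
    have "inj ?e"
      by (rule injI) (metis length_ray_prefix nat.inject)
    then have "bij_betw ?e UNIV (range ?e)"
      by (simp add: bij_betw_def)
    have e: "?e k \<in> tree b - {[]}" "hd (?e k) = \<xi> 1" for k
      using ray_prefix_in_level[OF \<xi>, of "Suc k"]
      by (auto simp: tree_def hd_ray_prefix) (metis length_0_conv length_ray_prefix nat.distinct(1))
    have "(\<Sum>k. ?f (?e k)) = (\<integral>\<^sup>+k. ?f (?e k) \<partial>count_space UNIV)"
      by (rule nn_integral_count_space_nat[symmetric])
    also have "\<dots> = (\<integral>\<^sup>+v. ?f v \<partial>count_space (range ?e))"
      by (rule nn_integral_bij_count_space) fact
    also have "\<dots> = (\<integral>\<^sup>+v. ?f v * indicator (range ?e) v \<partial>count_space (range ?e))"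
      by (intro nn_integral_cong) (auto simp: indicator_def)
    also have "\<dots> = (\<integral>\<^sup>+v. ?f v * indicator (range ?e) v \<partial>?X)"
      using e by (intro nn_integral_count_space_eq) (auto simp: indicator_def)
    also have "\<dots> \<le> C (\<xi> 1)"
      unfolding C_def using e by (intro nn_integral_mono mult_left_mono) (auto simp: indicator_def)
    finally have "(\<Sum>k. ?f (?e k)) \<le> ennreal (enn2real (C (\<xi> 1)))"
      by (simp add: C)
    then show ?thesis
      unfolding ray_abs_sum_def t_def
      by (intro suminf_le_powr_suminf_powr \<alpha>) auto
  qed
  have "mean_measure b A h \<le> mean_measure b A (level_one_field (\<lambda>i. \<sigma> * t i))"
    unfolding mean_measure_def
  proof (rule integral_mono_AE)
    have "AE \<xi> in boundary_measure b. ennreal \<bar>ray_sum h \<xi>\<bar> \<le> ray_abs_sum h \<xi>"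
      using AE_ray_sum_le[OF b_pos, of h] h by (simp add: tree_fields_def)
    then show "AE \<xi> in boundary_measure b. shifted_measure A (ray_sum h \<xi>) \<le>
        shifted_measure A (ray_sum (level_one_field (\<lambda>i. \<sigma> * t i)) \<xi>)"
      using AE_space
    proof eventually_elim
      case (elim \<xi>)
      then have "ennreal \<bar>ray_sum h \<xi>\<bar> \<le> ennreal (t (\<xi> 1))"
        using ray[of \<xi>] by (meson order_trans)
      then have "\<bar>ray_sum h \<xi>\<bar> \<le> t (\<xi> 1)"
        by (simp add: t_def)
      then show ?case
        by (simp add: ray_sum_level_one shifted_measure_le_abs)
    qed
  qed (intro integrable_shifted_measure[OF b_pos A] measurable_ray_sum[OF b_pos])+
  then have "s \<in> one_level_costs b \<alpha> A \<sigma> (mean_measure b A h)"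
    unfolding one_level_costs_def s_def mean_measure_level_one[OF b_pos A]
    by (auto simp: t_def intro!: exI[of _ t])
  ultimately show thesis
    using that by blast
qed

text \<open>Jensen's inequality for the concave function, in the form of a supporting line at \<open>T\<close>.\<close>

lemma tree_norm_ge_of_concave:
  assumes conc: "concave_on {0..} (\<lambda>t. shifted_measure A (\<sigma> * t))" and "T > 0"
    and h: "h \<in> tree_fields b" and mean: "mean_measure b A h = shifted_measure A (\<sigma> * T)"
  shows "ennreal T \<le> tree_norm b h"
proof -
  let ?G = "\<lambda>t. shifted_measure A (\<sigma> * t)"
  obtain m where m: "?G y \<le> ?G T + m * (y - T)" if "y \<ge> 0" for y
  proof -
    \<comment> \<open>The infimum of the right-hand difference quotients of the convex function
      \<open>- ?G\<close> at \<open>T\<close> is the slope of a supporting line.\<close>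
    let ?m = "Inf ((\<lambda>t. (- ?G T - - ?G t) / (T - t)) ` ({T<..} \<inter> {0..}))"
    have "- ?G y \<ge> - ?G T + ?m * (y - T)" if "y \<ge> 0" for y
      using conc that \<open>T > 0\<close>
      by (intro convex_le_Inf_differential[of "{0..}" "\<lambda>t. - ?G t"])
         (auto simp: concave_on_def)
    then show thesis
      using that[of "- ?m"] by (simp add: algebra_simps)
  qed
  \<comment> \<open>At \<open>T + 1\<close> the supporting line lies above the function, which
    exceeds \<open>?G T\<close> there.\<close>
  have "m > 0"
    using m[of "T + 1"] strict_monoD[OF mono, of T "T + 1"] \<open>T > 0\<close> by simp
  have norm: "tree_norm b h < \<infinity>"
    using h by (simp add: tree_fields_def)
  have nn: "(\<integral>\<^sup>+\<xi>. ennreal \<bar>ray_sum h \<xi>\<bar> \<partial>boundary_measure b) \<le> tree_norm b h"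
    unfolding nn_integral_ray_abs_sum[OF b_pos, symmetric]
    by (intro nn_integral_mono_AE AE_ray_sum_le b_pos norm)
  have int: "integrable (boundary_measure b) (\<lambda>\<xi>. \<bar>ray_sum h \<xi>\<bar>)"
    using le_less_trans[OF nn norm] measurable_ray_sum[OF b_pos, of h]
    by (intro integrableI_bounded) auto
  have "?G T = (\<integral>\<xi>. shifted_measure A (ray_sum h \<xi>) \<partial>boundary_measure b)"
    using mean by (simp add: mean_measure_def)
  \<comment> \<open>Passing to the absolute value only raises the measure, by monotonicity, and puts
    the argument on the half-line where the supporting line is valid.\<close>
  also have "\<dots> \<le> (\<integral>\<xi>. ?G T + m * (\<bar>ray_sum h \<xi>\<bar> - T) \<partial>boundary_measure b)"
    using int
    by (intro integral_mono integrable_shifted_measure[OF b_pos A] measurable_ray_sum[OF b_pos])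
       (auto intro!: order_trans[OF shifted_measure_le_abs m])
  also have "\<dots> = ?G T + m * ((\<integral>\<xi>. \<bar>ray_sum h \<xi>\<bar> \<partial>boundary_measure b) - T)"
    using int by (simp add: B.prob_space)
  finally have "T \<le> (\<integral>\<xi>. \<bar>ray_sum h \<xi>\<bar> \<partial>boundary_measure b)"
    using \<open>m > 0\<close> by (simp add: zero_le_mult_iff)
  then have "ennreal T \<le> ennreal (\<integral>\<xi>. \<bar>ray_sum h \<xi>\<bar> \<partial>boundary_measure b)"
    by (rule ennreal_leI)
  also have "\<dots> \<le> tree_norm b h"
    using nn int by (simp add: nn_integral_eq_integral)
  finally show ?thesis .
qed

section \<open>Values of the minimal cost\<close>

text \<open>The upper bound comes from the value \<open>\<sigma> * T\<close> at every first-level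
  vertex, the lower bound from the norm estimate.\<close>

lemma min_cost_concave_1:
  assumes conc: "concave_on {0..} (\<lambda>t. shifted_measure A (\<sigma> * t))" and "lam > 0"
    and T: "T > 0" "shifted_measure A (\<sigma> * T) = p"
  shows "min_cost b 1 lam A p = ennreal (lam * real b * T)"
proof (rule antisym)
  have "p \<ge> measure gauss A"
    using strict_monoD[OF mono T(1)] T by (simp add: shifted_measure_0)
  moreover have "real b * T \<in> one_level_costs b 1 A \<sigma> p"
    using T b by (auto simp: one_level_costs_def intro!: exI[of _ "\<lambda>_. T"])
  ultimately have "min_cost b 1 lam A p \<le> ennreal (lam * (real b * T))"
    using \<open>lam > 0\<close> by (intro min_cost_le_one_level) auto
  then show "min_cost b 1 lam A p \<le> ennreal (lam * real b * T)"
    by (simp add: mult.assoc)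
  show "ennreal (lam * real b * T) \<le> min_cost b 1 lam A p"
    unfolding min_cost_def using T \<open>lam > 0\<close>
    by (intro INF_greatest field_cost_ge_of_tree_norm_ge_1 b_pos tree_norm_ge_of_concave conc) auto
qed

lemma min_cost_concave_gt_1:
  assumes conc: "concave_on {0..} (\<lambda>t. shifted_measure A (\<sigma> * t))" and "lam > 0"
    and \<alpha>: "\<alpha> > 1" and T: "T > 0" "shifted_measure A (\<sigma> * T) = p"
  shows "min_cost b \<alpha> lam A p =
    ennreal (lam * (real b powr (1 / (\<alpha> - 1)) - 1) powr (\<alpha> - 1) * T powr \<alpha>)"
proof (rule antisym)
  define q where "q = real b powr (- (1 / (\<alpha> - 1)))"
  define c where "c = real b powr (1 / (\<alpha> - 1)) - 1"
  note opt = b \<alpha> T(1) q_def c_def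
  let ?h = "radial_field (\<lambda>n. \<sigma> * (T * c * q ^ n))"
  have abs: "\<bar>\<sigma> * (T * c * q ^ Suc k)\<bar> = T * c * q ^ Suc k" for k
    unfolding abs_mult[of \<sigma>] using \<sigma> holder_q[OF opt] T by (auto simp: abs_mult)
  have "tree_norm b ?h = ennreal T"
    unfolding tree_norm_radial[OF b_pos] abs
    using holder_field_sums[OF opt] holder_q[OF opt] T by (intro suminf_ennreal_eq) auto
  then have "?h \<in> tree_fields b"
    by (simp add: tree_fields_def radial_field_def)
  \<comment> \<open>Every ray sum equals \<open>\<sigma> * T\<close>, so the radial field meets the
    constraint with equality.\<close>
  moreover have "mean_measure b A ?h = p"
    using sums_unique[OF sums_mult[OF holder_field_sums[OF opt], of \<sigma>]] T
    by (simp add: mean_measure_def ray_sum_radial B.prob_space)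
  ultimately have "min_cost b \<alpha> lam A p \<le> field_cost b \<alpha> lam ?h"
    unfolding min_cost_def by (intro INF_lower) simp
  then show "min_cost b \<alpha> lam A p \<le>
      ennreal (lam * (real b powr (1 / (\<alpha> - 1)) - 1) powr (\<alpha> - 1) * T powr \<alpha>)"
    using \<sigma> \<open>lam > 0\<close> by (subst (asm) field_cost_holder_field[OF opt]) (auto simp: c_def)
  show "ennreal (lam * (real b powr (1 / (\<alpha> - 1)) - 1) powr (\<alpha> - 1) * T powr \<alpha>) \<le>
      min_cost b \<alpha> lam A p"
    unfolding min_cost_def c_def[symmetric] using T \<open>lam > 0\<close>
    by (intro INF_greatest field_cost_ge_of_tree_norm_ge[OF opt] tree_norm_ge_of_concave conc) auto
qed

lemma min_cost_le_1:
  assumes \<alpha>: "0 < \<alpha>" "\<alpha> \<le> 1" and "lam > 0"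
    and T: "T > 0" "shifted_measure A (\<sigma> * T) = p"
  shows "\<exists>m. m \<in> one_level_costs b \<alpha> A \<sigma> p \<and> (\<forall>s\<in>one_level_costs b \<alpha> A \<sigma> p. m \<le> s) \<and>
    min_cost b \<alpha> lam A p = ennreal (lam * m)"
proof -
  obtain m where m: "m \<in> one_level_costs b \<alpha> A \<sigma> p"
    "\<And>s. s \<in> one_level_costs b \<alpha> A \<sigma> p \<Longrightarrow> m \<le> s"
    using one_level_costs_min[of \<alpha> T p] \<alpha> T by (metis less_imp_le order_refl)
  have "p \<ge> measure gauss A"
    using strict_monoD[OF mono T(1)] T by (simp add: shifted_measure_0)
  then have "min_cost b \<alpha> lam A p \<le> ennreal (lam * m)"
    using \<open>lam > 0\<close> \<alpha> m by (intro min_cost_le_one_level) auto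
  moreover have "ennreal (lam * m) \<le> min_cost b \<alpha> lam A p"
    unfolding min_cost_def
  proof (rule INF_greatest)
    fix h assume h: "h \<in> {h \<in> tree_fields b. mean_measure b A h = p}"
    show "ennreal (lam * m) \<le> field_cost b \<alpha> lam h"
    \<comment> \<open>The collapse to one level works with finite subtree costs; a field of infinite
      cost satisfies the bound trivially.\<close>
    proof (cases "field_cost b \<alpha> lam h < \<infinity>")
      case True
      then obtain s where s: "s \<in> one_level_costs b \<alpha> A \<sigma> p" "ennreal (lam * s) \<le> field_cost b \<alpha> lam h"
        using field_cost_ge_one_level[OF \<alpha> \<open>lam > 0\<close>, of h] h by auto
      then show ?thesis
        using m(2)[of s] \<open>lam > 0\<close> by (meson ennreal_leI less_imp_le mult_left_mono order_trans)
    qed (simp add: less_top[symmetric])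
  qed
  ultimately show ?thesis
    using m by (intro exI[of _ m]) auto
qed

end

theorem theorem4p3:
  fixes b r :: nat and \<alpha> lam \<sigma> p :: real and A :: "real set"
  assumes "b \<ge> 2" and "\<alpha> > 0" and "lam > 0"
    and "r \<ge> 1" and "disjoint_interval_union r A"
    and "A \<noteq> {}" and "A \<noteq> UNIV"
    and "\<sigma> \<in> {-1, 1}" and "strict_mono (\<lambda>t. shifted_measure A (\<sigma> * t))"
    and "p \<in> {measure gauss A <..< sup_shifted_measure A}"
  shows "(min_cost b \<alpha> lam A \<longlongrightarrow> min_cost_right b \<alpha> lam A p) (at_right p) \<and>
     min_cost_right b \<alpha> lam A p = min_cost b \<alpha> lam A p \<and>
     (\<alpha> \<le> 1 \<longrightarrow>
        (\<exists>m. m \<in> one_level_costs b \<alpha> A \<sigma> p \<and>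
             (\<forall>s\<in>one_level_costs b \<alpha> A \<sigma> p. m \<le> s) \<and>
             min_cost b \<alpha> lam A p = ennreal (lam * m))) \<and>
     (\<alpha> \<ge> 1 \<and> concave_on {0..} (\<lambda>t. shifted_measure A (\<sigma> * t)) \<longrightarrow>
        min_cost b \<alpha> lam A p =
          (if \<alpha> = 1 then ennreal (lam * real b * min_shift A p)
           else ennreal (lam * (real b powr (1 / (\<alpha> - 1)) - 1) powr (\<alpha> - 1)
                         * min_shift A p powr \<alpha>)))"
proof -
  have A: "finite (frontier A)"
    using assms(5) by (rule disjoint_interval_union_frontier_finite)
  note target = assms(1) A assms(8,9)
  have p: "measure gauss A < p" "p < sup_shifted_measure A"
    using assms(10) by auto
  obtain T where T: "T > 0" "shifted_measure A (\<sigma> * T) = p"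
    using ex_shift_eq[OF target p] by blast
  \<comment> \<open>\<open>min_cost_right\<close> is a \<open>Lim\<close>, whose value is determined
    once convergence is known, so convergence comes first.\<close>
  have lim: "(min_cost b \<alpha> lam A \<longlongrightarrow> min_cost b \<alpha> lam A p) (at_right p)"
    using assms p by (intro min_cost_right_continuous[OF _ A]) auto
  then have right: "min_cost_right b \<alpha> lam A p = min_cost b \<alpha> lam A p"
    unfolding min_cost_right_def by (intro tendsto_Lim) auto
  show ?thesis
    unfolding right min_shift_eq[OF target T]
    using lim assms(2,3) min_cost_le_1[OF target _ _ _ T]
      min_cost_concave_1[OF target _ _ T] min_cost_concave_gt_1[OF target _ _ _ T]
    by auto
qed

end
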